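(* Let Assumption 1 (stated in the context) hold, and let $F$ be convex and strongly convex in the sense that there are $\sigma>0$ and an optimal solution $x^*$ of $\min_{x\in\mathcal X}F(x)$ with $F(x)-F(x^* )\ge\sigma\|x-x^*\|^2$ for all $x\in\mathcal X$. Let $\{(x_k,y_k)\}$ be generated by the basic SCGD algorithm (defined in the context) with stepsizes, for $k\ge1$, $$\alpha_k=\frac1{k\sigma},\qquad\beta_k=\frac1{(k\sigma)^{2/3}}$$ (and $\alpha_0,\beta_0\in(0,1]$ arbitrary). Then $$\mathbf E[\|x_k-x^*\|^2]=\mathcal O\Big(\frac{C_fC_g}{\sigma^2}\frac{\log k}{k}+\frac{L_f^2C_g(C_fC_g^2+V_g)}{\sigma^{8/3}}\frac1{k^{2/3}}\Big)=\mathcal O\Big(\frac1{k^{2/3}}\Big),$$ and, with $\widehat x_k=\frac1{N_k}\sum_{t=k-N_k+1}^{k}x_t$, $N_k=\lceil k/2\rceil$, $$\mathbf E[\|\widehat x_k-x^*\|^2]=\mathcal O\Big(\frac1{k^{2/3}}\Big).$$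
   Context: Problem. Minimize $F(x)=f(g(x))$ over $x\in\mathcal X\subset\mathbb R^n$, where $f:\mathbb R^m\to\mathbb R$, $g:\mathbb R^n\to\mathbb R^m$, $f(y)=\mathbf E[f_v(y)]$, $g(x)=\mathbf E[g_w(x)]$ and $(w,v)$ is a pair of (possibly dependent) random variables. $\|\cdot\|$ is the Euclidean norm (operator norm for matrices) and $\Pi_{\mathcal X}$ is Euclidean projection onto $\mathcal X$. $\partial F(x)$ is the subdifferential of $F$ at $x$, equal to $\{\nabla F(x)\}$ when $F$ is differentiable. For each realization $w$ and each $x\in\mathcal X$, $\widetilde\nabla g_w(x)\in\mathbb R^{n\times m}$ is a given random matrix (a noisy generalized gradient of $g$, whose $j$-th column corresponds to the $j$-th component of $g$). For sequences, $a_k=\mathcal O(b_k)$ means there is $c>0$ independent of $k$ with $|a_k|\le c\,|b_k|$ for all $k\ge1$. Assumption 1. There are positive scalars $C_g,C_f,V_g,L_f$ such that: (i) $f$ is continuously differentiable, $g$ is continuous, $\mathcal X$ is nonempty, closed and convex. (ii) $(w_0,v_0),(w_1,v_1),\dots$ are i.i.d. (copies of $(w,v)$), and with probability 1, for all $x\in\mathcal X$, $\mathbf E[g_{w_0}(x)\mid v_0]=g(x)$ and $\mathbf E[\widetilde\nabla g_{w_0}(x)\nabla f_{v_0}(g(x))\mid v_0]\in\partial F(x)$. (iii) $g$ is Lipschitz continuous with parameter $C_g$, and with probability 1, for all $x\in\mathcal X$, $\mathbf E[\|\widetilde\nabla g_{w_0}(x)\|^2\mid v_0]\le C_g$ and $\mathbf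 E[\|g_{w_0}(x)-g(x)\|^2\mid v_0]\le V_g$. (iv) With probability 1, for all $y,\bar y\in\mathbb R^m$, $\mathbf E[\|\nabla f_{v_0}(y)\|^2\mid w_0]\le C_f$ and $\|\nabla f_{v_0}(y)-\nabla f_{v_0}(\bar y)\|\le L_f\|y-\bar y\|$; $f$ likewise has Lipschitz continuous gradient. Basic SCGD algorithm. Given deterministic $x_0\in\mathcal X$, $y_0\in\mathbb R^m$ and positive stepsizes $\alpha_k,\beta_k$, for $k=0,1,2,\dots$: $$y_{k+1}=(1-\beta_k)y_k+\beta_k g_{w_k}(x_k),\qquad x_{k+1}=\Pi_{\mathcal X}\big\{x_k-\alpha_k\widetilde\nabla g_{w_k}(x_k)\nabla f_{v_k}(y_{k+1})\big\}.$$ *)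

theory Defs
  imports "HOL-Probability.Probability"
begin

definition gradient :: "('a::real_inner \<Rightarrow> real) \<Rightarrow> 'a \<Rightarrow> 'a" where
  "gradient h x = (THE D. GDERIV h x :> D)"

lemma gradient_eqI:
  fixes h :: "'a::real_inner \<Rightarrow> real"
  assumes "GDERIV h x :> D"
  shows "gradient h x = D"
  unfolding gradient_def
proof (rule the_equality)
  show "GDERIV h x :> D" by (rule assms)
next
  fix D' assume "GDERIV h x :> D'"
  then have "(\<lambda>z. z \<bullet> D') = (\<lambda>z. z \<bullet> D)"
    using assms unfolding gderiv_def by (rule has_derivative_unique)
  then have "(D' - D) \<bullet> (D' - D) = 0"
    by (metis inner_diff_right right_minus_eq)
  then show "D' = D" by simp
qed

text \<open>Subdifferential in the sense of convex analysis; the function is defined on the whole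
  space, so the subgradient inequality ranges over all points.\<close>

definition subdifferential :: "('a::real_inner \<Rightarrow> real) \<Rightarrow> 'a \<Rightarrow> 'a set" where
  "subdifferential F x = {s. \<forall>z. F x + s \<bullet> (z - x) \<le> F z}"

lemma subdifferential_differentiable:
  fixes F :: "'a::real_inner \<Rightarrow> real"
  assumes convex: "convex_on UNIV F" and deriv: "GDERIV F x :> D"
  shows "subdifferential F x = {D}"
proof -
  have line: "((\<lambda>t. F (x + t *\<^sub>R d)) has_real_derivative d \<bullet> D) (at 0)" for d
  proof -
    have "((\<lambda>t. x + t *\<^sub>R d) has_derivative (\<lambda>t. t *\<^sub>R d)) (at 0)"
      by (auto intro!: derivative_eq_intros)
    moreover have "(F has_derivative (\<lambda>h. h \<bullet> D)) (at (x + 0 *\<^sub>R d))"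
      using deriv by (simp add: gderiv_def)
    ultimately have "((\<lambda>t. F (x + t *\<^sub>R d)) has_derivative (\<lambda>t. (t *\<^sub>R d) \<bullet> D)) (at 0)"
      by (rule has_derivative_compose)
    then show ?thesis
      by (simp add: has_field_derivative_def mult_commute_abs)
  qed
  have lim: "((\<lambda>t. (F (x + t *\<^sub>R d) - F x) / t) \<longlongrightarrow> d \<bullet> D) (at_right 0)" for d
    using line[of d] unfolding DERIV_def
    by (auto intro: filterlim_mono[OF _ order_refl at_le])
  have "D \<in> subdifferential F x"
    unfolding subdifferential_def
  proof (safe)
    fix z
    have below_1: "eventually (\<lambda>t. t < 1) (at_right (0::real))"
      by (intro order_tendstoD(2)[OF tendsto_ident_at]) simp
    have "eventually (\<lambda>t. (F (x + t *\<^sub>R (z - x)) - F x) / t \<le> F z - F x) (at_right 0)"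
      using eventually_at_right_less[of "0::real"] below_1
    proof eventually_elim
      case (elim t)
      have "F ((1 - t) *\<^sub>R x + t *\<^sub>R z) \<le> (1 - t) * F x + t * F z"
        using elim by (intro convex_onD[OF convex]) (auto intro: exI[of _ 1])
      moreover have "(1 - t) *\<^sub>R x + t *\<^sub>R z = x + t *\<^sub>R (z - x)"
        by (simp add: algebra_simps)
      ultimately show ?case
        using elim by (auto simp: field_simps)
    qed
    then have "(z - x) \<bullet> D \<le> F z - F x"
      using lim[of "z - x"] by (intro tendsto_upperbound) auto
    then show "F x + D \<bullet> (z - x) \<le> F z" by (simp add: inner_commute)
  qed
  moreover have "s = D" if s: "s \<in> subdifferential F x" for s
  proof -
    let ?d = "D - s"
    have ev: "eventually (\<lambda>t. (F (x + t *\<^sub>R (- ?d)) - F x) / t \<ge> s \<bullet> (- ?d)) (at_right 0)"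
      using eventually_at_right_less[of "0::real"]
    proof eventually_elim
      case (elim t)
      have "F x + s \<bullet> (x + t *\<^sub>R (- ?d) - x) \<le> F (x + t *\<^sub>R (- ?d))"
        using s unfolding subdifferential_def by blast
      then have "F x + t * (s \<bullet> (- ?d)) \<le> F (x + t *\<^sub>R (- ?d))"
        by (simp only: add_diff_cancel_left' inner_scaleR_right)
      then have "t * (s \<bullet> (- ?d)) \<le> F (x + t *\<^sub>R (- ?d)) - F x" by linarith
      then show ?case using elim by (simp only: pos_le_divide_eq mult.commute)
    qed
    have "s \<bullet> (- ?d) \<le> (- ?d) \<bullet> D"
      using lim[of "- ?d"] ev by (intro tendsto_lowerbound) auto
    then have "?d \<bullet> ?d \<le> 0"
      by (simp add: inner_diff_left inner_diff_right inner_commute)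
    then have "?d = 0" by (metis inner_eq_zero_iff inner_ge_zero order_antisym)
    then show ?thesis by simp
  qed
  ultimately show ?thesis by blast
qed

text \<open>The library only provides conditional expectations of scalar functions.\<close>

definition vec_cond_exp ::
    "'a measure \<Rightarrow> 'a measure \<Rightarrow> ('a \<Rightarrow> real^'d) \<Rightarrow> 'a \<Rightarrow> real^'d" where
  "vec_cond_exp M A Z \<omega> = (\<chi> i. real_cond_exp M A (\<lambda>\<omega>'. Z \<omega>' $ i) \<omega>)"

definition generated_algebra :: "'a measure \<Rightarrow> 'b measure \<Rightarrow> ('a \<Rightarrow> 'b) \<Rightarrow> 'a measure" where
  "generated_algebra M N Z = vimage_algebra (space M) Z N"

definition op_norm :: "real^'m^'n \<Rightarrow> real" where
  "op_norm A = onorm ((*v) A)"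

text \<open>Unlike membership in the library's Landau sets, which only concerns large indices, the bound
  is required for every index from 1 on.\<close>

definition seq_bigO :: "(nat \<Rightarrow> real) \<Rightarrow> (nat \<Rightarrow> real) \<Rightarrow> bool" where
  "seq_bigO a b \<longleftrightarrow> (\<exists>c>0. \<forall>k\<ge>1. \<bar>a k\<bar> \<le> c * \<bar>b k\<bar>)"

text \<open>Here \<open>Gw w x\<close> is the noisy generalized gradient of \<open>g\<close>, with rows indexed by the coordinates of
  \<open>x\<close> and columns by the components of \<open>g\<close>; only its values for \<open>x \<in> X\<close> are constrained. The sample
  spaces \<open>W\<close> and \<open>V\<close> are arbitrary measurable spaces. Joint measurability of the sampled
  functions in sample and point makes the iterates random variables.\<close>

locale stochastic_composition = prob_space M
  for M :: "'a measure" +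
  fixes W :: "'w measure" and V :: "'v measure"
    and w :: "nat \<Rightarrow> 'a \<Rightarrow> 'w" and v :: "nat \<Rightarrow> 'a \<Rightarrow> 'v"
    and f\<^sub>v :: "'v \<Rightarrow> real^'m \<Rightarrow> real"
    and g\<^sub>w :: "'w \<Rightarrow> real^'n \<Rightarrow> real^'m"
    and Gw :: "'w \<Rightarrow> real^'n \<Rightarrow> real^'m^'n"
    and f :: "real^'m \<Rightarrow> real" and g :: "real^'n \<Rightarrow> real^'m"
    and X :: "(real^'n) set"
  assumes w_measurable: "\<And>k. w k \<in> M \<rightarrow>\<^sub>M W"
    and v_measurable: "\<And>k. v k \<in> M \<rightarrow>\<^sub>M V"
    and g\<^sub>w_measurable:
      "(\<lambda>(\<xi>, x). g\<^sub>w \<xi> x) \<in> borel_measurable (W \<Otimes>\<^sub>M restrict_space borel X)"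
    and Gw_measurable:
      "(\<lambda>(\<xi>, x). Gw \<xi> x) \<in> borel_measurable (W \<Otimes>\<^sub>M restrict_space borel X)"
    and grad_f\<^sub>v_measurable:
      "(\<lambda>(\<zeta>, y). gradient (f\<^sub>v \<zeta>) y) \<in> borel_measurable (V \<Otimes>\<^sub>M borel)"
    and f_integrable: "\<And>y. integrable M (\<lambda>\<omega>. f\<^sub>v (v 0 \<omega>) y)"
    and f_expectation: "\<And>y. f y = expectation (\<lambda>\<omega>. f\<^sub>v (v 0 \<omega>) y)"
    and g_integrable: "\<And>x. integrable M (\<lambda>\<omega>. g\<^sub>w (w 0 \<omega>) x)"
    and g_expectation: "\<And>x. g x = expectation (\<lambda>\<omega>. g\<^sub>w (w 0 \<omega>) x)"

text \<open>A conditional expectation is determined only up to a null set, for each point \<open>x\<close> or \<open>y\<close>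
  separately; hence the almost-sure statements about conditional expectations are made pointwise.
  Second moments use the \<open>ennreal\<close>-valued conditional expectation, since the real-valued
  one is 0 where the conditional expectation is infinite.\<close>

locale scgd_problem = stochastic_composition M W V w v f\<^sub>v g\<^sub>w Gw f g X
  for M :: "'a measure" and W :: "'w measure" and V :: "'v measure"
    and w v
    and f\<^sub>v :: "'v \<Rightarrow> real^'m \<Rightarrow> real"
    and g\<^sub>w :: "'w \<Rightarrow> real^'n \<Rightarrow> real^'m"
    and Gw f g X +
  fixes C\<^sub>g C\<^sub>f V\<^sub>g L\<^sub>f :: real
  assumes constants_pos: "C\<^sub>g > 0" "C\<^sub>f > 0" "V\<^sub>g > 0" "L\<^sub>f > 0"
    and f_differentiable: "\<And>y. f differentiable (at y)"
    and grad_f_continuous: "continuous_on UNIV (gradient f)"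
    and g_continuous: "continuous_on UNIV g"
    and X_nonempty: "X \<noteq> {}" and X_closed: "closed X" and X_convex: "convex X"
    and samples_indep:
      "indep_vars (\<lambda>_. W \<Otimes>\<^sub>M V) (\<lambda>k \<omega>. (w k \<omega>, v k \<omega>)) UNIV"
    and samples_identically_distributed:
      "\<And>k. distr M (W \<Otimes>\<^sub>M V) (\<lambda>\<omega>. (w k \<omega>, v k \<omega>))
            = distr M (W \<Otimes>\<^sub>M V) (\<lambda>\<omega>. (w 0 \<omega>, v 0 \<omega>))"
    and g\<^sub>w_cond_unbiased:
      "\<And>x. x \<in> X \<Longrightarrow> AE \<omega> in M.
         vec_cond_exp M (generated_algebra M V (v 0)) (\<lambda>\<omega>'. g\<^sub>w (w 0 \<omega>') x) \<omega> = g x"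
    and sample_grad_cond_unbiased:
      "\<And>x. x \<in> X \<Longrightarrow> AE \<omega> in M.
         vec_cond_exp M (generated_algebra M V (v 0))
           (\<lambda>\<omega>'. Gw (w 0 \<omega>') x *v gradient (f\<^sub>v (v 0 \<omega>')) (g x)) \<omega>
         \<in> subdifferential (f \<circ> g) x"
    and g_lipschitz: "C\<^sub>g-lipschitz_on UNIV g"
    and Gw_second_moment:
      "\<And>x. x \<in> X \<Longrightarrow> AE \<omega> in M.
         nn_cond_exp M (generated_algebra M V (v 0)) (\<lambda>\<omega>'. ennreal ((op_norm (Gw (w 0 \<omega>') x))\<^sup>2)) \<omega>
         \<le> ennreal C\<^sub>g"
    and g\<^sub>w_variance:
      "\<And>x. x \<in> X \<Longrightarrow> AE \<omega> in M.
         nn_cond_exp M (generated_algebra M V (v 0)) (\<lambda>\<omega>'. ennreal ((norm (g\<^sub>w (w 0 \<omega>') x - g x))\<^sup>2)) \<omega>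
         \<le> ennreal V\<^sub>g"
    and f\<^sub>v_differentiable: "AE \<omega> in M. \<forall>y. f\<^sub>v (v 0 \<omega>) differentiable (at y)"
    and grad_f\<^sub>v_second_moment:
      "\<And>y. AE \<omega> in M.
         nn_cond_exp M (generated_algebra M W (w 0)) (\<lambda>\<omega>'. ennreal ((norm (gradient (f\<^sub>v (v 0 \<omega>')) y))\<^sup>2)) \<omega>
         \<le> ennreal C\<^sub>f"
    and grad_f\<^sub>v_lipschitz:
      "AE \<omega> in M. \<forall>y y'. norm (gradient (f\<^sub>v (v 0 \<omega>)) y - gradient (f\<^sub>v (v 0 \<omega>)) y') \<le> L\<^sub>f * norm (y - y')"
    and grad_f_lipschitz: "L\<^sub>f-lipschitz_on UNIV (gradient f)"

definition basic_scgd ::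
  "'a measure \<Rightarrow> (nat \<Rightarrow> 'a \<Rightarrow> 'w) \<Rightarrow> (nat \<Rightarrow> 'a \<Rightarrow> 'v)
    \<Rightarrow> ('v \<Rightarrow> real^'m \<Rightarrow> real) \<Rightarrow> ('w \<Rightarrow> real^'n \<Rightarrow> real^'m) \<Rightarrow> ('w \<Rightarrow> real^'n \<Rightarrow> real^'m^'n)
    \<Rightarrow> (real^'n) set \<Rightarrow> (nat \<Rightarrow> real) \<Rightarrow> (nat \<Rightarrow> real) \<Rightarrow> real^'n \<Rightarrow> real^'m
    \<Rightarrow> (nat \<Rightarrow> 'a \<Rightarrow> real^'n) \<Rightarrow> (nat \<Rightarrow> 'a \<Rightarrow> real^'m) \<Rightarrow> bool" where
  "basic_scgd M w v f\<^sub>v g\<^sub>w Gw X \<alpha> \<beta> x\<^sub>0 y\<^sub>0 x y \<longleftrightarrow>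
     (\<forall>\<omega>\<in>space M. x 0 \<omega> = x\<^sub>0 \<and> y 0 \<omega> = y\<^sub>0 \<and>
       (\<forall>k. y (Suc k) \<omega> = (1 - \<beta> k) *\<^sub>R y k \<omega> + \<beta> k *\<^sub>R g\<^sub>w (w k \<omega>) (x k \<omega>) \<and>
            x (Suc k) \<omega> = closest_point X
              (x k \<omega> - \<alpha> k *\<^sub>R (Gw (w k \<omega>) (x k \<omega>) *v gradient (f\<^sub>v (v k \<omega>)) (y (Suc k) \<omega>)))))"

definition half_window :: "nat \<Rightarrow> nat" where
  "half_window k = nat \<lceil>real k / 2\<rceil>"

definition tail_average :: "(nat \<Rightarrow> 'a \<Rightarrow> real^'n) \<Rightarrow> nat \<Rightarrow> 'a \<Rightarrow> real^'n" where
  "tail_average x k \<omega> =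
     (1 / real (half_window k)) *\<^sub>R (\<Sum>t = k - half_window k + 1..k. x t \<omega>)"

end

theory Submission
  imports Defs "HOL-Real_Asymp.Real_Asymp"
begin

text \<open>Write \<open>e k\<close> for the expectation of \<open>\<parallel>x k - x_opt\<parallel>\<^sup>2\<close> and \<open>p k\<close> for that of
  \<open>\<parallel>y k - g (x k)\<parallel>\<^sup>2\<close>. The samples of step \<open>k\<close> are independent of the iterates \<open>x k\<close>, \<open>y k\<close>, so by
  Fubini all one-step estimates may be made at fixed \<open>x\<close> and \<open>y\<close>. Replacing the gradient
  at \<open>y (k + 1)\<close> by the one at \<open>g (x k)\<close>, for which the step is an unbiased subgradient step, costs an error that
  the inequality between arithmetic and geometric means splits into \<open>\<alpha> k * \<sigma> * e k\<close>, which half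
  of the strong convexity gain absorbs, and a multiple of \<open>\<alpha> k\<close> times the tracking error.
  With \<open>\<alpha> k = 1 / (k * \<sigma>)\<close> this gives \<open>k * e (k + 1) \<le> (k - 1) * e k + O(1 / k + p k + (\<beta> k)\<^sup>2)\<close>.
  The tracking error obeys \<open>p (k + 1) \<le> (1 - \<beta> k) * p k + O((\<beta> k)\<^sup>2 + (\<alpha> k)\<^sup>2 / \<beta> k)\<close> as soon as
  \<open>\<beta> k \<le> 1\<close>. The choice \<open>\<beta> k \<approx> k powr (-2/3)\<close> balances both perturbations at order
  \<open>k powr (-4/3)\<close>, whence \<open>p k = O(k powr (-2/3))\<close>, and summation yields the rate of \<open>e k\<close>.\<close>

subsection \<open>Recursions with rate $k^{-2/3}$\<close>

text \<open>The sequence \<open>D * k powr (-2/3)\<close> is a supersolution: its decrement from k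
  to k + 1 has order k powr (-5/3), negligible against the damping
  \<open>b * D * k powr (-4/3)\<close>, so half of the damping is left to absorb \<open>K\<close>.
  The recursion is asked for only eventually because step sizes of size at most 1 occur only from
  some index on.\<close>

lemma damped_recursion_two_thirds:
  fixes d :: "nat \<Rightarrow> real" and b K :: real
  assumes b: "b > 0" and K: "K \<ge> 0"
    and d_nonneg: "\<And>k. d k \<ge> 0"
    and rec: "eventually (\<lambda>k. d (Suc k) \<le> (1 - b * real k powr (-2/3)) * d k
                 + K * real k powr (-4/3)) sequentially"
  shows "\<exists>D>0. \<forall>k\<ge>1. d k \<le> D * real k powr (-2/3)"
proof -
  \<comment> \<open>The left side is k powr (-2/3) minus the full damping
    \<open>b * k powr (-4/3)\<close>; giving back half of it pays for the o(k powr (-4/3))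
    decrement.\<close>
  have "eventually (\<lambda>k. real k powr (-2/3) * (1 - b * real k powr (-2/3))
      \<le> real (Suc k) powr (-2/3) - b / 2 * real k powr (-4/3)) sequentially"
    using b by real_asymp
  moreover have "eventually (\<lambda>k. b * real k powr (-2/3) \<le> 1) sequentially"
    using b by real_asymp
  ultimately have "eventually (\<lambda>k. k \<ge> 1 \<and> b * real k powr (-2/3) \<le> 1 \<and>
      d (Suc k) \<le> (1 - b * real k powr (-2/3)) * d k + K * real k powr (-4/3) \<and>
      real k powr (-2/3) * (1 - b * real k powr (-2/3))
      \<le> real (Suc k) powr (-2/3) - b / 2 * real k powr (-4/3)) sequentially"
    using rec eventually_ge_at_top[of 1] by eventually_elim simp
  then obtain k0 where k0: "\<And>k. k \<ge> k0 \<Longrightarrow> k \<ge> 1 \<and> b * real k powr (-2/3) \<le> 1 \<and>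
      d (Suc k) \<le> (1 - b * real k powr (-2/3)) * d k + K * real k powr (-4/3) \<and>
      real k powr (-2/3) * (1 - b * real k powr (-2/3))
      \<le> real (Suc k) powr (-2/3) - b / 2 * real k powr (-4/3)"
    unfolding eventually_sequentially by blast
  \<comment> \<open>\<open>2 * K / b\<close> makes the remaining half of the damping dominate
    \<open>K\<close>, the sum covers the finitely many indices up to \<open>k0\<close>, and 1 keeps
    \<open>D\<close> positive.\<close>
  define D where "D = 1 + 2 * K / b + (\<Sum>k\<le>k0. d k * real k powr (2/3))"
  have S_nonneg: "(\<Sum>k\<le>k0. d k * real k powr (2/3)) \<ge> 0"
    using d_nonneg by (intro sum_nonneg) auto
  have D: "D > 0" "D * b / 2 \<ge> K"
    using b K S_nonneg unfolding D_def by (auto simp: field_simps add_pos_nonneg)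
  have small: "d k \<le> D * real k powr (-2/3)" if "1 \<le> k" "k \<le> k0" for k
  proof -
    have "d k * real k powr (2/3) \<le> (\<Sum>k\<le>k0. d k * real k powr (2/3))"
      using that d_nonneg by (intro member_le_sum) auto
    also have "\<dots> \<le> D" using b K by (simp add: D_def)
    finally have "d k * real k powr (2/3) * real k powr (-2/3) \<le> D * real k powr (-2/3)"
      by (rule mult_right_mono) simp
    then show ?thesis using that by (simp add: mult.assoc powr_add[symmetric])
  qed
  have large: "d k \<le> D * real k powr (-2/3)" if "k \<ge> k0" for k
    using that
  proof (induction k rule: dec_induct)
    case base
    then show ?case using small k0[of k0] by simp
  next
    case (step k)
    let ?p = "real k powr (-2/3)" and ?q = "real k powr (-4/3)"
    note k = k0[OF step(1)]
    have "d (Suc k) \<le> (1 - b * ?p) * d k + K * ?q" using k by simp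
    also have "\<dots> \<le> (1 - b * ?p) * (D * ?p) + K * ?q"
      using k step.IH by (intro add_right_mono mult_left_mono) auto
    also have "\<dots> = D * (?p * (1 - b * ?p)) + K * ?q" by (simp add: algebra_simps)
    also have "\<dots> \<le> D * (real (Suc k) powr (-2/3) - b / 2 * ?q) + K * ?q"
      using k D by (intro add_right_mono mult_left_mono) auto
    also have "\<dots> = D * real (Suc k) powr (-2/3) + (K - D * b / 2) * ?q" by (simp add: algebra_simps)
    also have "\<dots> \<le> D * real (Suc k) powr (-2/3)"
      using D by (simp add: mult_nonpos_nonneg)
    finally show ?case .
  qed
  show ?thesis using D(1) small large by (meson nat_le_linear)
qed

text \<open>Discrete counterpart of the fact that 3 x powr (1/3) is an antiderivative of x powr
  (-2/3), meant for telescoping. With the cube roots s and t of k and k - 1, the factorization 1 =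
  s^3 - t^3 = (s - t)(s^2 + st + t^2) is at most 3 s^2 (s - t).\<close>

lemma powr_neg_two_thirds_le_diff:
  fixes k :: nat assumes "k \<ge> 1"
  shows "real k powr (-2/3) \<le> 3 * real k powr (1/3) - 3 * real (k - 1) powr (1/3)"
proof -
  define s t where "s = real k powr (1/3)" and "t = real (k - 1) powr (1/3)"
  have st: "s > 0" "t \<ge> 0" "t \<le> s"
    using assms by (auto simp: s_def t_def intro!: powr_mono2)
  have cube: "s ^ 3 - t ^ 3 = 1"
    using assms by (cases "k = 1") (simp_all add: s_def t_def powr_power)
  have "t\<^sup>2 \<le> s\<^sup>2" "s * t \<le> s\<^sup>2"
    using st by (simp_all add: power2_eq_square mult_mono)
  then have "s\<^sup>2 + s * t + t\<^sup>2 \<le> 3 * s\<^sup>2" by linarith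
  then have "(s - t) * (s\<^sup>2 + s * t + t\<^sup>2) \<le> (s - t) * (3 * s\<^sup>2)"
    using st by (intro mult_left_mono) auto
  then have "1 \<le> (s - t) * (3 * s\<^sup>2)"
    using cube by (simp add: algebra_simps power2_eq_square power3_eq_cube)
  then have "1 / s\<^sup>2 \<le> 3 * s - 3 * t"
    using st by (simp add: field_simps)
  moreover have "1 / s\<^sup>2 = real k powr (-2/3)"
    using assms powr_minus_divide[of "real k" "2/3"] by (simp add: s_def powr_power)
  ultimately show ?thesis by (simp add: s_def t_def)
qed

text \<open>Places the logarithmic term of the stated rate below the second term, by bounding ln k
  through the power k powr (1/3).\<close>

lemma ln_over_le_powr_neg_two_thirds:
  fixes k :: real assumes "k \<ge> 1"
  shows "ln k / k \<le> 3 * k powr (-2/3)"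
proof -
  have "ln k / k \<le> k powr (1/3) / (1/3) / k"
    using assms by (intro divide_right_mono ln_powr_bound) auto
  also have "\<dots> = 3 * (k powr (1/3) / k powr 1)"
    using assms by simp
  also have "\<dots> = 3 * k powr (-2/3)"
    unfolding powr_diff[symmetric] by simp
  finally show ?thesis .
qed

text \<open>Halving the index costs the factor 2 powr (2/3), rounded up to 2. It serves both for
  shifting an index by one and for comparing all indices of an averaging window with k.\<close>

lemma powr_neg_two_thirds_le_double:
  fixes k t :: real
  assumes "k > 0" "k \<le> 2 * t"
  shows "t powr (-2/3) \<le> 2 * k powr (-2/3)"
proof -
  have "t powr (-2/3) \<le> (k / 2) powr (-2/3)"
    using assms by (intro powr_mono2') auto
  also have "\<dots> = 2 powr (2/3) * k powr (-2/3)"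
    using assms by (simp add: powr_divide powr_minus field_simps)
  also have "\<dots> \<le> 2 powr 1 * k powr (-2/3)"
    by (intro mult_right_mono powr_mono) auto
  finally show ?thesis by simp
qed

text \<open>The weights make the left sides telescope: \<open>k * e (k + 1)\<close> is at most
  \<open>E\<close> times the sum of j powr (-2/3) for j up to k, hence of order k powr (1/3), and
  division by k gives the rate.\<close>

lemma weighted_recursion_two_thirds:
  fixes e :: "nat \<Rightarrow> real"
  assumes E: "E \<ge> 0"
    and e_nonneg: "\<And>k. e k \<ge> 0"
    and rec: "\<And>k. k \<ge> 1 \<Longrightarrow> real k * e (Suc k) \<le> real (k - 1) * e k + E * real k powr (-2/3)"
  shows "\<exists>D>0. \<forall>k\<ge>1. e k \<le> D * real k powr (-2/3)"
proof -
  \<comment> \<open>At k = 0 both sides vanish because \<open>0 powr (1/3)\<close> is 0, so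
    \<open>e 1\<close> does not enter the telescoped bound.\<close>
  have *: "real k * e (Suc k) \<le> 3 * E * real k powr (1/3)" for k
  proof (induction k)
    case (Suc k)
    have "real (Suc k) * e (Suc (Suc k)) \<le> real k * e (Suc k) + E * real (Suc k) powr (-2/3)"
      using rec[of "Suc k"] by simp
    also have "\<dots> \<le> 3 * E * real k powr (1/3)
        + E * (3 * real (Suc k) powr (1/3) - 3 * real k powr (1/3))"
      using Suc E powr_neg_two_thirds_le_diff[of "Suc k"] by (intro add_mono mult_left_mono) auto
    finally show ?case by (simp add: algebra_simps)
  qed simp
  \<comment> \<open>\<open>e 1\<close> settles the index 1, which the telescoped bound does not
    reach; \<open>6 * E\<close> is \<open>3 * E\<close> times the factor 2 for passing from
    \<open>j\<close> to \<open>j + 1\<close>.\<close>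
  define D where "D = 1 + e 1 + 6 * E"
  have "e k \<le> D * real k powr (-2/3)" if k: "k \<ge> 1" for k
  proof (cases "k = 1")
    case True
    then show ?thesis using E by (simp add: D_def)
  next
    case False
    then obtain j where j: "k = Suc j" "j \<ge> 1" using k by (cases k) auto
    have "e k \<le> 3 * E * (real j powr (1/3) / real j)"
      using *[of j] j by (simp add: field_simps)
    also have "real j powr (1/3) / real j = real j powr (-2/3)"
      using j powr_diff[of "real j" "1/3" 1] by simp
    also have "real j powr (-2/3) \<le> 2 * real k powr (-2/3)"
      using j by (intro powr_neg_two_thirds_le_double) auto
    finally have "e k \<le> 3 * E * (2 * real k powr (-2/3))"
      using E by (simp add: mult_left_mono)
    also have "\<dots> \<le> D * real k powr (-2/3)"
      using e_nonneg[of 1] by (simp add: D_def algebra_simps)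
    finally show ?thesis .
  qed
  moreover have "D > 0" using E e_nonneg[of 1] by (simp add: D_def)
  ultimately show ?thesis by blast
qed

subsection \<open>Operator norms and conditional bounds\<close>

lemma norm_matrix_vector_le_op_norm:
  fixes A :: "real^'m^'n"
  shows "norm (A *v z) \<le> op_norm A * norm z"
  unfolding op_norm_def by (rule onorm) (rule matrix_vector_mul_bounded_linear)

lemma op_norm_nonneg: "op_norm (A :: real^'m^'n) \<ge> 0"
  unfolding op_norm_def by (rule onorm_pos_le) (rule matrix_vector_mul_bounded_linear)

text \<open>Subadditivity leaves \<open>op_norm (A - B)\<close>, which the sum of the absolute
  entries dominates. Used in both orders it yields continuity, and with it measurability, of
  \<open>op_norm\<close>.\<close>

lemma op_norm_diff_le:
  fixes A B :: "real^'m^'n"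
  shows "op_norm A - op_norm B \<le> (\<Sum>i\<in>UNIV. \<Sum>j\<in>UNIV. \<bar>A $ i $ j - B $ i $ j\<bar>)"
proof -
  have "op_norm A \<le> op_norm B + op_norm (A - B)"
    unfolding op_norm_def
    by (rule order_trans[OF _ onorm_triangle])
       (auto simp: matrix_vector_mul_bounded_linear matrix_vector_mult_add_rdistrib[symmetric])
  moreover have "op_norm (A - B) \<le> (\<Sum>i\<in>UNIV. \<Sum>j\<in>UNIV. \<bar>(A - B) $ i $ j\<bar>)"
    unfolding op_norm_def by (rule onorm_le_matrix_component_sum)
  ultimately show ?thesis by simp
qed

lemma continuous_op_norm: "continuous_on UNIV (op_norm :: real^'m^'n \<Rightarrow> real)"
proof -
  have "(op_norm \<longlongrightarrow> op_norm A) (at A)" for A :: "real^'m^'n"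
  proof (rule tendsto_dist_iff[THEN iffD2], rule tendsto_sandwich[OF _ _ tendsto_const])
    let ?S = "\<lambda>B. \<Sum>i\<in>UNIV. \<Sum>j\<in>UNIV. \<bar>B $ i $ j - A $ i $ j\<bar>"
    show "\<forall>\<^sub>F B in at A. dist (op_norm B) (op_norm A) \<le> ?S B"
    proof (rule always_eventually, rule allI)
      fix B :: "real^'m^'n"
      show "dist (op_norm B) (op_norm A) \<le> ?S B"
        using op_norm_diff_le[of A B] op_norm_diff_le[of B A]
        by (simp add: dist_real_def abs_minus_commute abs_le_iff)
    qed
    have "(?S \<longlongrightarrow> ?S A) (at A)"
      by (intro tendsto_intros)
    then show "(?S \<longlongrightarrow> 0) (at A)" by simp
  qed auto
  then show ?thesis by (simp add: continuous_on_def)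
qed

lemma borel_measurable_op_norm [measurable]:
  "(op_norm :: real^'m^'n \<Rightarrow> real) \<in> borel_measurable borel"
  by (rule borel_measurable_continuous_onI[OF continuous_op_norm])

lemma borel_measurable_matrix_vector_mult [measurable (raw)]:
  fixes A :: "'a \<Rightarrow> real^'m^'n"
  assumes "A \<in> borel_measurable M" "z \<in> borel_measurable M"
  shows "(\<lambda>\<omega>. A \<omega> *v z \<omega>) \<in> borel_measurable M"
  using assms
proof (rule borel_measurable_continuous_Pair)
  show "continuous_on UNIV (\<lambda>p :: (real^'m^'n) \<times> (real^'m). fst p *v snd p)"
    unfolding matrix_vector_mult_def
    by (intro continuous_on_vec_lambda continuous_intros)
qed

section \<open>Conditional moment bounds in integrated form\<close>

context prob_space
begin

lemma sigma_finite_generated_algebra: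
  assumes "Z \<in> M \<rightarrow>\<^sub>M N"
  shows "sigma_finite_subalgebra M (generated_algebra M N Z)"
proof -
  have "subalgebra M (generated_algebra M N Z)"
    using assms unfolding subalgebra_def generated_algebra_def
    by (auto simp: sets_vimage_algebra2 measurable_space measurable_sets)
  then interpret finite_measure_subalgebra M "generated_algebra M N Z"
    by unfold_locales
  show ?thesis by unfold_locales
qed

text \<open>Against a weight that is a function of \<open>Z\<close>, the integral of
  \<open>h\<close> equals that of its conditional expectation given \<open>Z\<close>. The weight 1
  gives plain moments; other weights allow localization to events determined by
  \<open>Z\<close>.\<close>

lemma nn_integral_cond_bound:
  assumes Z: "Z \<in> M \<rightarrow>\<^sub>M N" and h: "h \<in> borel_measurable M"
    and bound: "AE \<omega> in M. nn_cond_exp M (generated_algebra M N Z) h \<omega> \<le> c"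
    and \<phi>: "\<phi> \<in> borel_measurable N"
  shows "(\<integral>\<^sup>+\<omega>. \<phi> (Z \<omega>) * h \<omega> \<partial>M) \<le> c * (\<integral>\<^sup>+\<omega>. \<phi> (Z \<omega>) \<partial>M)"
proof -
  interpret sigma_finite_subalgebra M "generated_algebra M N Z"
    by (rule sigma_finite_generated_algebra[OF Z])
  have "Z \<in> generated_algebra M N Z \<rightarrow>\<^sub>M N"
    unfolding generated_algebra_def
    using Z by (intro measurable_vimage_algebra1) (auto dest: measurable_space)
  then have "(\<lambda>\<omega>. \<phi> (Z \<omega>)) \<in> borel_measurable (generated_algebra M N Z)"
    using \<phi> by (rule measurable_compose)
  then have "(\<integral>\<^sup>+\<omega>. \<phi> (Z \<omega>) * h \<omega> \<partial>M)
      = (\<integral>\<^sup>+\<omega>. \<phi> (Z \<omega>) * nn_cond_exp M (generated_algebra M N Z) h \<omega> \<partial>M)"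
    using h by (rule nn_cond_exp_intg[symmetric])
  also have "\<dots> \<le> (\<integral>\<^sup>+\<omega>. c * \<phi> (Z \<omega>) \<partial>M)"
  proof (rule nn_integral_mono_AE, use bound in eventually_elim)
    case (elim \<omega>)
    then have "nn_cond_exp M (generated_algebra M N Z) h \<omega> * \<phi> (Z \<omega>) \<le> c * \<phi> (Z \<omega>)"
      by (rule mult_right_mono) simp
    then show ?case by (simp only: mult.commute)
  qed
  also have "\<dots> = c * (\<integral>\<^sup>+\<omega>. \<phi> (Z \<omega>) \<partial>M)"
    using Z \<phi> by (intro nn_integral_cmult) simp
  finally show ?thesis .
qed

text \<open>A bound on a conditional expectation that holds for every fixed parameter does not survive
  substituting a random parameter in general; continuity in the parameter makes it do so.\<close>

lemma nn_integral_cond_bound_subst: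
  fixes h :: "'a \<Rightarrow> 'b::{metric_space, second_countable_topology} \<Rightarrow> ennreal"
  assumes Z: "Z \<in> M \<rightarrow>\<^sub>M N" and h: "\<And>q. (\<lambda>\<omega>. h \<omega> q) \<in> borel_measurable M"
    and cont: "AE \<omega> in M. continuous_on UNIV (h \<omega>)"
    and bound: "\<And>q. AE \<omega> in M. nn_cond_exp M (generated_algebra M N Z) (\<lambda>\<omega>. h \<omega> q) \<omega> \<le> c"
    and \<phi> [measurable]: "\<phi> \<in> borel_measurable N" and \<phi>_fin: "\<And>z. \<phi> z < \<infinity>"
    and Y: "Y \<in> borel_measurable N"
  shows "(\<integral>\<^sup>+\<omega>. \<phi> (Z \<omega>) * h \<omega> (Y (Z \<omega>)) \<partial>M) \<le> c * (\<integral>\<^sup>+\<omega>. \<phi> (Z \<omega>) \<partial>M)"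
proof -
  have Zs: "Z \<omega> \<in> space N" if "\<omega> \<in> space M" for \<omega>
    using Z that by (rule measurable_space)
  \<comment> \<open>Simple functions converging pointwise to \<open>Y\<close>: each takes finitely
    many values, and for a fixed value the assumed bound applies.\<close>
  obtain s where s: "\<And>i. simple_function N (s i)"
      and lim: "\<And>z. z \<in> space N \<Longrightarrow> (\<lambda>i. s i z) \<longlonglongrightarrow> Y z"
    using borel_measurable_implies_sequence_metric[OF Y] by meson
  note [measurable] = Z h
  have fin: "finite (s i ` space N)" for i
    using s by (rule simple_functionD)
  have sets [measurable]: "{z \<in> space N. s i z = q} \<in> sets N" for i q
    using simple_functionD(2)[OF s, of i "{q}"] by (simp add: vimage_def Int_def conj_commute)
  \<comment> \<open>The weight localized to the level set where \<open>s i\<close> equals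
    \<open>q\<close>; on it the random parameter is the constant \<open>q\<close>.\<close>
  define \<psi> where "\<psi> i q z = \<phi> z * indicator {z \<in> space N. s i z = q} z" for i q z
  have \<psi>_meas [measurable]: "\<psi> i q \<in> borel_measurable N" for i q
    unfolding \<psi>_def by measurable
  have split: "u (s i z) * \<phi> z = (\<Sum>q\<in>s i ` space N. u q * \<psi> i q z)" if "z \<in> space N" for u i z
  proof -
    have "(\<Sum>q\<in>s i ` space N. u q * \<psi> i q z) = (\<Sum>q\<in>s i ` space N. if q = s i z then u q * \<phi> z else 0)"
      using that by (intro sum.cong) (auto simp: \<psi>_def)
    also have "\<dots> = u (s i z) * \<phi> z"
      using that fin by (simp add: sum.delta)
    finally show ?thesis by simp
  qed
  have simple: "(\<lambda>\<omega>. \<phi> (Z \<omega>) * h \<omega> (s i (Z \<omega>))) \<in> borel_measurable M" (is ?meas)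
    and simple_le: "(\<integral>\<^sup>+\<omega>. \<phi> (Z \<omega>) * h \<omega> (s i (Z \<omega>)) \<partial>M) \<le> c * (\<integral>\<^sup>+\<omega>. \<phi> (Z \<omega>) \<partial>M)" (is ?le)
    for i
  proof -
    have eq: "\<phi> (Z \<omega>) * h \<omega> (s i (Z \<omega>)) = (\<Sum>q\<in>s i ` space N. \<psi> i q (Z \<omega>) * h \<omega> q)"
      if "\<omega> \<in> space M" for \<omega>
      using split[OF Zs[OF that], of "h \<omega>" i] by (simp add: mult.commute)
    have "(\<lambda>\<omega>. \<Sum>q\<in>s i ` space N. \<psi> i q (Z \<omega>) * h \<omega> q) \<in> borel_measurable M"
      by measurable
    then show ?meas by (simp add: eq cong: measurable_cong)
    have "(\<integral>\<^sup>+\<omega>. \<phi> (Z \<omega>) * h \<omega> (s i (Z \<omega>)) \<partial>M)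
        = (\<Sum>q\<in>s i ` space N. \<integral>\<^sup>+\<omega>. \<psi> i q (Z \<omega>) * h \<omega> q \<partial>M)"
      by (simp add: eq nn_integral_sum cong: nn_integral_cong)
    also have "\<dots> \<le> (\<Sum>q\<in>s i ` space N. c * (\<integral>\<^sup>+\<omega>. \<psi> i q (Z \<omega>) \<partial>M))"
      by (intro sum_mono nn_integral_cond_bound[OF Z h bound]) simp
    also have "\<dots> = c * (\<integral>\<^sup>+\<omega>. (\<Sum>q\<in>s i ` space N. \<psi> i q (Z \<omega>)) \<partial>M)"
      by (simp add: nn_integral_sum sum_distrib_left)
    also have "\<dots> = c * (\<integral>\<^sup>+\<omega>. \<phi> (Z \<omega>) \<partial>M)"
      using split[OF Zs, of _ "\<lambda>_. 1" i] by (auto cong: nn_integral_cong)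
    finally show ?le .
  qed
  have "(\<integral>\<^sup>+\<omega>. \<phi> (Z \<omega>) * h \<omega> (Y (Z \<omega>)) \<partial>M)
      \<le> (\<integral>\<^sup>+\<omega>. liminf (\<lambda>i. \<phi> (Z \<omega>) * h \<omega> (s i (Z \<omega>))) \<partial>M)"
  \<comment> \<open>Continuity in the parameter identifies the integrand with the limit along the
    simple functions, and Fatou's lemma then moves the liminf outside. Finiteness of the weight
    enters because multiplication by infinity is not continuous on \<open>ennreal\<close>.\<close>
  proof (rule nn_integral_mono_AE, use cont AE_space in eventually_elim)
    case (elim \<omega>)
    have "(\<lambda>i. h \<omega> (s i (Z \<omega>))) \<longlonglongrightarrow> h \<omega> (Y (Z \<omega>))"
      using elim(1) lim[OF Zs[OF elim(2)]]
      by (intro continuous_on_tendsto_compose[OF elim(1)]) auto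
    then have "(\<lambda>i. \<phi> (Z \<omega>) * h \<omega> (s i (Z \<omega>))) \<longlonglongrightarrow> \<phi> (Z \<omega>) * h \<omega> (Y (Z \<omega>))"
      using \<phi>_fin by (intro ennreal_tendsto_cmult) (auto simp: top.not_eq_extremum)
    then show ?case by (simp add: lim_imp_Liminf)
  qed
  also have "\<dots> \<le> liminf (\<lambda>i. \<integral>\<^sup>+\<omega>. \<phi> (Z \<omega>) * h \<omega> (s i (Z \<omega>)) \<partial>M)"
    by (intro nn_integral_liminf simple)
  also have "\<dots> \<le> liminf (\<lambda>i. c * (\<integral>\<^sup>+\<omega>. \<phi> (Z \<omega>) \<partial>M))"
    by (intro Liminf_mono always_eventually allI simple_le)
  also have "\<dots> = c * (\<integral>\<^sup>+\<omega>. \<phi> (Z \<omega>) \<partial>M)"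
    by (simp add: lim_imp_Liminf)
  finally show ?thesis .
qed

lemma integrable_expectation_le_of_nn_integral:
  fixes h :: "'a \<Rightarrow> real"
  assumes "h \<in> borel_measurable M" "\<And>\<omega>. h \<omega> \<ge> 0" "C \<ge> 0"
    and "(\<integral>\<^sup>+\<omega>. ennreal (h \<omega>) \<partial>M) \<le> ennreal C"
  shows "integrable M h" "expectation h \<le> C"
proof -
  show int: "integrable M h"
    using assms by (intro integrableI_nonneg) (auto intro: le_less_trans)
  then have "ennreal (expectation h) = (\<integral>\<^sup>+\<omega>. ennreal (h \<omega>) \<partial>M)"
    using assms by (intro nn_integral_eq_integral[symmetric]) auto
  then show "expectation h \<le> C"
    using assms by (metis ennreal_le_iff)
qed

end

subsection \<open>Moments of one step from a fixed point\<close>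

context scgd_problem
begin

lemmas [measurable] = w_measurable v_measurable

lemma measurable_const_in_X:
  assumes "x \<in> X"
  shows "(\<lambda>\<xi>. (\<xi>, x)) \<in> W \<rightarrow>\<^sub>M W \<Otimes>\<^sub>M restrict_space borel X"
  using assms by (intro measurable_Pair measurable_ident measurable_const)
    (auto simp: space_restrict_space)

lemma measurable_g\<^sub>w_fixed:
  assumes "x \<in> X" shows "(\<lambda>\<xi>. g\<^sub>w \<xi> x) \<in> borel_measurable W"
  using measurable_compose[OF measurable_const_in_X[OF assms] g\<^sub>w_measurable] by simp

lemma measurable_Gw_fixed:
  assumes "x \<in> X" shows "(\<lambda>\<xi>. Gw \<xi> x) \<in> borel_measurable W"
  using measurable_compose[OF measurable_const_in_X[OF assms] Gw_measurable] by simp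

lemma measurable_grad [measurable (raw)]:
  assumes "\<zeta> \<in> N \<rightarrow>\<^sub>M V" "y \<in> borel_measurable N"
  shows "(\<lambda>\<omega>. gradient (f\<^sub>v (\<zeta> \<omega>)) (y \<omega>)) \<in> borel_measurable N"
  using measurable_compose[OF measurable_Pair[OF assms] grad_f\<^sub>v_measurable] by simp

lemma Gw_second_moment_integral:
  assumes x: "x \<in> X"
  shows "(\<integral>\<^sup>+\<omega>. ennreal ((op_norm (Gw (w 0 \<omega>) x))\<^sup>2) \<partial>M) \<le> ennreal C\<^sub>g"
proof -
  note [measurable] = measurable_Gw_fixed[OF x]
  show ?thesis
    using nn_integral_cond_bound[OF v_measurable _ Gw_second_moment[OF x], of "\<lambda>_. 1"]
    by (simp add: emeasure_space_1)
qed

lemma g\<^sub>w_variance_integral: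
  assumes x: "x \<in> X"
  shows "(\<integral>\<^sup>+\<omega>. ennreal ((norm (g\<^sub>w (w 0 \<omega>) x - g x))\<^sup>2) \<partial>M) \<le> ennreal V\<^sub>g"
proof -
  note [measurable] = measurable_g\<^sub>w_fixed[OF x]
  show ?thesis
    using nn_integral_cond_bound[OF v_measurable _ g\<^sub>w_variance[OF x], of "\<lambda>_. 1"]
    by (simp add: emeasure_space_1)
qed

text \<open>The two factors are treated in turn. Given \<open>w 0\<close>, both the matrix norm and
  the point \<open>Y (w 0)\<close> are known, so the conditional bound for the gradient contributes
  \<open>C\<^sub>f\<close>; the remaining matrix moment contributes \<open>C\<^sub>g\<close>. The
  point depends on \<open>w 0\<close> because the algorithm evaluates the gradient at an average
  that already contains the current sample.\<close>

lemma direction_second_moment_nn: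
  assumes x: "x \<in> X" and Y: "Y \<in> borel_measurable W"
  shows "(\<integral>\<^sup>+\<omega>. ennreal ((norm (Gw (w 0 \<omega>) x *v gradient (f\<^sub>v (v 0 \<omega>)) (Y (w 0 \<omega>))))\<^sup>2) \<partial>M)
    \<le> ennreal (C\<^sub>f * C\<^sub>g)"
proof -
  note [measurable] = measurable_Gw_fixed[OF x] Y
  let ?h = "\<lambda>\<omega> q. ennreal ((norm (gradient (f\<^sub>v (v 0 \<omega>)) q))\<^sup>2)"
  have cont: "AE \<omega> in M. continuous_on UNIV (?h \<omega>)"
    using grad_f\<^sub>v_lipschitz
  proof eventually_elim
    case (elim \<omega>)
    then have "L\<^sub>f-lipschitz_on UNIV (gradient (f\<^sub>v (v 0 \<omega>)))"
      using constants_pos by (intro lipschitz_onI) (auto simp: dist_norm)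
    from lipschitz_on_continuous_on[OF this] show ?case
      by (intro continuous_on_ennreal continuous_intros)
  qed
  have "(\<integral>\<^sup>+\<omega>. ennreal ((norm (Gw (w 0 \<omega>) x *v gradient (f\<^sub>v (v 0 \<omega>)) (Y (w 0 \<omega>))))\<^sup>2) \<partial>M)
      \<le> (\<integral>\<^sup>+\<omega>. ennreal ((op_norm (Gw (w 0 \<omega>) x))\<^sup>2) * ?h \<omega> (Y (w 0 \<omega>)) \<partial>M)"
    by (intro nn_integral_mono)
       (auto simp: ennreal_mult[symmetric] power_mult_distrib[symmetric]
         intro!: ennreal_leI power_mono norm_matrix_vector_le_op_norm)
  also have "\<dots> \<le> ennreal C\<^sub>f * (\<integral>\<^sup>+\<omega>. ennreal ((op_norm (Gw (w 0 \<omega>) x))\<^sup>2) \<partial>M)"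
    using cont by (intro nn_integral_cond_bound_subst[where N = W] grad_f\<^sub>v_second_moment) auto
  also have "\<dots> \<le> ennreal C\<^sub>f * ennreal C\<^sub>g"
    by (intro mult_left_mono Gw_second_moment_integral x) simp
  finally show ?thesis
    using constants_pos by (simp add: ennreal_mult)
qed

lemma
  assumes x: "x \<in> X" and Y: "Y \<in> borel_measurable W"
  defines "H \<equiv> \<lambda>\<omega>. Gw (w 0 \<omega>) x *v gradient (f\<^sub>v (v 0 \<omega>)) (Y (w 0 \<omega>))"
  shows integrable_direction_square: "integrable M (\<lambda>\<omega>. (norm (H \<omega>))\<^sup>2)"
    and direction_second_moment: "expectation (\<lambda>\<omega>. (norm (H \<omega>))\<^sup>2) \<le> C\<^sub>f * C\<^sub>g"
    and integrable_direction: "integrable M H"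
proof -
  note [measurable] = measurable_Gw_fixed[OF x] Y
  have H [measurable]: "H \<in> borel_measurable M" unfolding H_def by measurable
  have nn: "(\<integral>\<^sup>+\<omega>. ennreal ((norm (H \<omega>))\<^sup>2) \<partial>M) \<le> ennreal (C\<^sub>f * C\<^sub>g)"
    using direction_second_moment_nn[OF x Y] by (simp add: H_def)
  show int: "integrable M (\<lambda>\<omega>. (norm (H \<omega>))\<^sup>2)"
    and "expectation (\<lambda>\<omega>. (norm (H \<omega>))\<^sup>2) \<le> C\<^sub>f * C\<^sub>g"
    using integrable_expectation_le_of_nn_integral[OF _ _ _ nn] constants_pos by auto
  have le: "t \<le> 1 + t\<^sup>2" for t :: real
    using sum_power2_ge_zero[of "t - 1/2" 0] by (simp add: power2_eq_square algebra_simps)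
  show "integrable M H"
    by (rule Bochner_Integration.integrable_bound[of _ "\<lambda>\<omega>. 1 + (norm (H \<omega>))\<^sup>2"])
       (use int le in auto)
qed

text \<open>The error at the new average is \<open>(1 - b)\<close> times the old error plus
  \<open>b\<close> times the centred noise \<open>q\<close>; the cross term has mean zero, which
  leaves squared bias plus variance.\<close>

lemma
  fixes b :: real and y :: "real^'m"
  assumes x: "x \<in> X"
  defines "Y \<equiv> \<lambda>\<omega>. (1 - b) *\<^sub>R y + b *\<^sub>R g\<^sub>w (w 0 \<omega>) x"
  shows integrable_tracking: "integrable M (\<lambda>\<omega>. (norm (Y \<omega> - g x))\<^sup>2)"
    and tracking_step:
      "expectation (\<lambda>\<omega>. (norm (Y \<omega> - g x))\<^sup>2) \<le> (1 - b)\<^sup>2 * (norm (y - g x))\<^sup>2 + b\<^sup>2 * V\<^sub>g"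
proof -
  note [measurable] = measurable_g\<^sub>w_fixed[OF x]
  define q where "q \<omega> = g\<^sub>w (w 0 \<omega>) x - g x" for \<omega>
  have q2: "integrable M (\<lambda>\<omega>. (norm (q \<omega>))\<^sup>2)" "expectation (\<lambda>\<omega>. (norm (q \<omega>))\<^sup>2) \<le> V\<^sub>g"
    using integrable_expectation_le_of_nn_integral[OF _ _ _ g\<^sub>w_variance_integral[OF x]] constants_pos
    by (auto simp: q_def)
  have q1: "integrable M q" "expectation q = 0"
    unfolding q_def using g_integrable[of x]
    by (simp_all add: g_expectation[of x] prob_space)
  have expand: "(norm (Y \<omega> - g x))\<^sup>2
      = (1 - b)\<^sup>2 * (norm (y - g x))\<^sup>2 + 2 * (1 - b) * b * ((y - g x) \<bullet> q \<omega>) + b\<^sup>2 * (norm (q \<omega>))\<^sup>2" for \<omega>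
  proof -
    have "(norm ((1 - b) *\<^sub>R p + b *\<^sub>R r))\<^sup>2
        = (1 - b)\<^sup>2 * (norm p)\<^sup>2 + 2 * (1 - b) * b * (p \<bullet> r) + b\<^sup>2 * (norm r)\<^sup>2" for p r :: "real^'m"
      unfolding power2_norm_eq_inner
      by (simp only: inner_add_left inner_add_right inner_scaleR_left inner_scaleR_right
          inner_commute[of r p] power2_eq_square) (simp only: algebra_simps)
    moreover have "Y \<omega> - g x = (1 - b) *\<^sub>R (y - g x) + b *\<^sub>R q \<omega>"
      by (simp add: Y_def q_def algebra_simps)
    ultimately show ?thesis by simp
  qed
  show "integrable M (\<lambda>\<omega>. (norm (Y \<omega> - g x))\<^sup>2)"
    unfolding expand using q1 q2 by auto
  have "expectation (\<lambda>\<omega>. (norm (Y \<omega> - g x))\<^sup>2)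
      = (1 - b)\<^sup>2 * (norm (y - g x))\<^sup>2 + b\<^sup>2 * expectation (\<lambda>\<omega>. (norm (q \<omega>))\<^sup>2)"
    unfolding expand using q1 q2 by (simp add: prob_space)
  also have "\<dots> \<le> (1 - b)\<^sup>2 * (norm (y - g x))\<^sup>2 + b\<^sup>2 * V\<^sub>g"
    using q2 by (intro add_left_mono mult_left_mono) auto
  finally show "expectation (\<lambda>\<omega>. (norm (Y \<omega> - g x))\<^sup>2) \<le> \<dots>" .
qed

text \<open>Almost surely the conditional expectation \<open>s\<close> of the sampled gradient is a
  subgradient at \<open>x\<close>. The subgradient inequality at \<open>z\<close> is linear in
  \<open>s\<close>, so it survives integration, and the tower property replaces the mean of
  \<open>s\<close> by that of the sampled gradient itself.\<close>

lemma expected_sample_gradient: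
  assumes x: "x \<in> X"
  shows "(f \<circ> g) x - (f \<circ> g) z
    \<le> (x - z) \<bullet> expectation (\<lambda>\<omega>. Gw (w 0 \<omega>) x *v gradient (f\<^sub>v (v 0 \<omega>)) (g x))"
proof -
  let ?A = "generated_algebra M V (v 0)"
  interpret A: sigma_finite_subalgebra M ?A
    by (rule sigma_finite_generated_algebra[OF v_measurable])
  define Q where "Q \<omega> = Gw (w 0 \<omega>) x *v gradient (f\<^sub>v (v 0 \<omega>)) (g x)" for \<omega>
  have Q: "integrable M Q"
    using integrable_direction[OF x, of "\<lambda>_. g x"] by (simp add: Q_def[abs_def])
  have Qi: "integrable M (\<lambda>\<omega>. Q \<omega> $ i)" "expectation (\<lambda>\<omega>. Q \<omega> $ i) = expectation Q $ i" for i
    using integrable_bounded_linear[OF bounded_linear_vec_nth Q]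
      integral_bounded_linear[OF bounded_linear_vec_nth Q] by auto
  define s where "s = vec_cond_exp M ?A Q"
  have si: "integrable M (\<lambda>\<omega>. s \<omega> $ i)" "expectation (\<lambda>\<omega>. s \<omega> $ i) = expectation Q $ i" for i
    using A.real_cond_exp_int[OF Qi(1)[of i]] Qi(2)[of i] by (simp_all add: s_def vec_cond_exp_def)
  have "AE \<omega> in M. s \<omega> \<in> subdifferential (f \<circ> g) x"
    unfolding s_def Q_def[abs_def] by (rule sample_grad_cond_unbiased[OF x])
  then have "AE \<omega> in M. (f \<circ> g) x - (f \<circ> g) z \<le> (\<Sum>i\<in>UNIV. (x - z) $ i * s \<omega> $ i)"
  proof eventually_elim
    case (elim \<omega>)
    then have "(f \<circ> g) x + s \<omega> \<bullet> (z - x) \<le> (f \<circ> g) z"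
      unfolding subdifferential_def by blast
    then have "(f \<circ> g) x - (f \<circ> g) z \<le> (x - z) \<bullet> s \<omega>"
      by (simp add: inner_diff_left inner_diff_right inner_commute)
    then show ?case by (simp add: inner_vec_def)
  qed
  then have "expectation (\<lambda>\<omega>. (f \<circ> g) x - (f \<circ> g) z)
      \<le> expectation (\<lambda>\<omega>. \<Sum>i\<in>UNIV. (x - z) $ i * s \<omega> $ i)"
    using si by (intro integral_mono_AE) auto
  also have "\<dots> = (x - z) \<bullet> expectation Q"
    using si by (simp add: inner_vec_def)
  finally show ?thesis by (simp add: prob_space Q_def[abs_def])
qed

lemma continuous_closest_point: "continuous_on UNIV (closest_point X)"
  by (rule continuous_on_closest_point[OF X_convex X_closed X_nonempty])

lemma borel_measurable_closest_point [measurable]: "closest_point X \<in> borel_measurable borel"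
  by (rule borel_measurable_continuous_onI[OF continuous_closest_point])

lemma borel_measurable_g [measurable]: "g \<in> borel_measurable borel"
  by (rule borel_measurable_continuous_onI[OF g_continuous])

lemma norm_closest_point_diff_le:
  assumes "z \<in> X" shows "norm (closest_point X u - z) \<le> norm (u - z)"
  using closest_point_lipschitz[OF X_convex X_closed X_nonempty, of u z] closest_point_self[OF assms]
  by (simp add: dist_norm)

text \<open>One step from a deterministic state. Projection onto \<open>X\<close> is nonexpansive
  and fixes both \<open>x\<close> and \<open>z\<close>, so it can only shorten the two distances. In
  the proof, \<open>H\<close> is the direction actually taken and \<open>Q\<close> the unbiased one
  with the gradient evaluated at \<open>g x\<close>.\<close>

lemma
  fixes a b \<sigma> :: real and y :: "real^'m"
  assumes x: "x \<in> X" and z: "z \<in> X" and a: "a \<ge> 0" and \<sigma>: "\<sigma> > 0"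
  defines "Y \<equiv> \<lambda>\<omega>. (1 - b) *\<^sub>R y + b *\<^sub>R g\<^sub>w (w 0 \<omega>) x"
  defines "x' \<equiv> \<lambda>\<omega>. closest_point X
      (x - a *\<^sub>R (Gw (w 0 \<omega>) x *v gradient (f\<^sub>v (v 0 \<omega>)) (Y \<omega>)))"
  shows integrable_projected_displacement: "integrable M (\<lambda>\<omega>. (norm (x' \<omega> - x))\<^sup>2)"
    and projected_displacement: "expectation (\<lambda>\<omega>. (norm (x' \<omega> - x))\<^sup>2) \<le> a\<^sup>2 * (C\<^sub>f * C\<^sub>g)"
    and integrable_projected_step: "integrable M (\<lambda>\<omega>. (norm (x' \<omega> - z))\<^sup>2)"
    and projected_step: "expectation (\<lambda>\<omega>. (norm (x' \<omega> - z))\<^sup>2)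
      \<le> (norm (x - z))\<^sup>2 - 2 * a * ((f \<circ> g) x - (f \<circ> g) z) + a * \<sigma> * (norm (x - z))\<^sup>2
        + a\<^sup>2 * (C\<^sub>f * C\<^sub>g)
        + a * L\<^sub>f\<^sup>2 * C\<^sub>g / \<sigma> * ((1 - b)\<^sup>2 * (norm (y - g x))\<^sup>2 + b\<^sup>2 * V\<^sub>g)"
proof -
  note [measurable] = measurable_Gw_fixed[OF x] measurable_g\<^sub>w_fixed[OF x]
  have Y [measurable]: "Y \<in> borel_measurable M" unfolding Y_def by measurable
  define H where "H \<omega> = Gw (w 0 \<omega>) x *v gradient (f\<^sub>v (v 0 \<omega>)) (Y \<omega>)" for \<omega>
  define Q where "Q \<omega> = Gw (w 0 \<omega>) x *v gradient (f\<^sub>v (v 0 \<omega>)) (g x)" for \<omega>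
  define G where "G \<omega> = op_norm (Gw (w 0 \<omega>) x)" for \<omega>
  have [measurable]: "x' \<in> borel_measurable M" unfolding x'_def by measurable
  have x': "x' \<omega> = closest_point X (x - a *\<^sub>R H \<omega>)" for \<omega>
    by (simp add: x'_def H_def)
  have Ymeas: "(\<lambda>\<xi>. (1 - b) *\<^sub>R y + b *\<^sub>R g\<^sub>w \<xi> x) \<in> borel_measurable W" by measurable
  have H2: "integrable M (\<lambda>\<omega>. (norm (H \<omega>))\<^sup>2)" "expectation (\<lambda>\<omega>. (norm (H \<omega>))\<^sup>2) \<le> C\<^sub>f * C\<^sub>g"
    unfolding H_def Y_def
    using integrable_direction_square[OF x Ymeas] direction_second_moment[OF x Ymeas] by simp_all
  have Q1: "integrable M Q"
    using integrable_direction[OF x, of "\<lambda>_. g x"] by (simp add: Q_def[abs_def])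
  have G2: "integrable M (\<lambda>\<omega>. (G \<omega>)\<^sup>2)" "expectation (\<lambda>\<omega>. (G \<omega>)\<^sup>2) \<le> C\<^sub>g"
    using integrable_expectation_le_of_nn_integral[OF _ _ _ Gw_second_moment_integral[OF x]]
      constants_pos by (auto simp: G_def)
  have Y2: "integrable M (\<lambda>\<omega>. (norm (Y \<omega> - g x))\<^sup>2)"
    and Y2_le: "expectation (\<lambda>\<omega>. (norm (Y \<omega> - g x))\<^sup>2) \<le> (1 - b)\<^sup>2 * (norm (y - g x))\<^sup>2 + b\<^sup>2 * V\<^sub>g"
    unfolding Y_def by (rule integrable_tracking[OF x], rule tracking_step[OF x])
  have disp: "(norm (x' \<omega> - x))\<^sup>2 \<le> a\<^sup>2 * (norm (H \<omega>))\<^sup>2" for \<omega>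
    using norm_closest_point_diff_le[OF x, of "x - a *\<^sub>R H \<omega>"] a
    by (simp add: x' power_mono flip: power_mult_distrib)
  show int1: "integrable M (\<lambda>\<omega>. (norm (x' \<omega> - x))\<^sup>2)"
    by (rule Bochner_Integration.integrable_bound[of _ "\<lambda>\<omega>. a\<^sup>2 * (norm (H \<omega>))\<^sup>2"])
       (use H2 disp in auto)
  have "expectation (\<lambda>\<omega>. (norm (x' \<omega> - x))\<^sup>2) \<le> expectation (\<lambda>\<omega>. a\<^sup>2 * (norm (H \<omega>))\<^sup>2)"
    using int1 H2 disp by (intro integral_mono) auto
  also have "\<dots> \<le> a\<^sup>2 * (C\<^sub>f * C\<^sub>g)" using H2 by (simp add: mult_left_mono)
  finally show "expectation (\<lambda>\<omega>. (norm (x' \<omega> - x))\<^sup>2) \<le> \<dots>" .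

  \<comment> \<open>A pathwise majorant in which every random summand has its own moment bound:
    \<open>Q\<close> by the subgradient inequality, \<open>G\<close> by \<open>C\<^sub>g\<close>,
    \<open>H\<close> by \<open>C\<^sub>f * C\<^sub>g\<close>, and \<open>Y\<close> by the tracking
    estimate.\<close>
  define u where "u \<omega> = (norm (x - z))\<^sup>2 - 2 * a * ((x - z) \<bullet> Q \<omega>)
      + a * \<sigma> * (norm (x - z))\<^sup>2 / C\<^sub>g * (G \<omega>)\<^sup>2
      + a\<^sup>2 * (norm (H \<omega>))\<^sup>2 + a * L\<^sub>f\<^sup>2 * C\<^sub>g / \<sigma> * (norm (Y \<omega> - g x))\<^sup>2" for \<omega>
  have u_int: "integrable M u"
    unfolding u_def[abs_def] using H2 Q1 G2 Y2 by auto
  have le: "AE \<omega> in M. (norm (x' \<omega> - z))\<^sup>2 \<le> u \<omega>"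
    using grad_f\<^sub>v_lipschitz
  proof eventually_elim
    case (elim \<omega>)
    let ?P = "norm (x - z)" and ?E = "norm (Y \<omega> - g x)"
    have G: "G \<omega> \<ge> 0" by (simp add: G_def op_norm_nonneg)
    have "norm (Q \<omega> - H \<omega>) \<le> G \<omega> * norm (gradient (f\<^sub>v (v 0 \<omega>)) (g x) - gradient (f\<^sub>v (v 0 \<omega>)) (Y \<omega>))"
      unfolding Q_def H_def G_def matrix_vector_mult_diff_distrib[symmetric]
      by (rule norm_matrix_vector_le_op_norm)
    also have "\<dots> \<le> G \<omega> * (L\<^sub>f * ?E)"
      using elim G by (intro mult_left_mono) (auto simp: norm_minus_commute)
    finally have QH: "norm (Q \<omega> - H \<omega>) \<le> G \<omega> * (L\<^sub>f * ?E)" .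
    have amgm: "2 * (r * t) \<le> s * r\<^sup>2 + t\<^sup>2 / s" if "s > 0" for r s t :: real
    proof -
      have "0 \<le> (s * r - t)\<^sup>2 / s" using that by simp
      then show ?thesis using that by (simp add: power2_eq_square field_simps)
    qed
    have "2 * ((x - z) \<bullet> (Q \<omega> - H \<omega>)) \<le> 2 * (?P * norm (Q \<omega> - H \<omega>))"
      by (simp add: norm_cauchy_schwarz)
    \<comment> \<open>\<open>G\<close> is grouped with the deterministic distance and not with the
      tracking error: both \<open>G\<close> and \<open>Y\<close> are functions of
      \<open>w 0\<close>, so the expectation of their product would not factor.\<close>
    also have "\<dots> \<le> 2 * ((?P * G \<omega>) * (L\<^sub>f * ?E))"
      using QH by (simp add: mult.assoc mult_left_mono)
    \<comment> \<open>The weight \<open>\<sigma> / C\<^sub>g\<close> is chosen so that the second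
      moment bound for \<open>G\<close> turns the first summand into exactly \<open>\<sigma>\<close>
      times the squared distance.\<close>
    also have "\<dots> \<le> \<sigma> / C\<^sub>g * (?P * G \<omega>)\<^sup>2 + (L\<^sub>f * ?E)\<^sup>2 / (\<sigma> / C\<^sub>g)"
      using \<sigma> constants_pos by (intro amgm) auto
    finally have cross: "2 * ((x - z) \<bullet> (Q \<omega> - H \<omega>))
        \<le> \<sigma> / C\<^sub>g * (?P * G \<omega>)\<^sup>2 + (L\<^sub>f * ?E)\<^sup>2 / (\<sigma> / C\<^sub>g)" .
    have "(norm (x' \<omega> - z))\<^sup>2 \<le> (norm (x - a *\<^sub>R H \<omega> - z))\<^sup>2"
      unfolding x' by (intro power_mono norm_closest_point_diff_le z) simp
    also have "\<dots> = (norm ((x - z) - a *\<^sub>R H \<omega>))\<^sup>2" by (simp add: algebra_simps)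
    also have "\<dots> = ?P\<^sup>2 - 2 * a * ((x - z) \<bullet> H \<omega>) + a\<^sup>2 * (norm (H \<omega>))\<^sup>2"
      unfolding power2_norm_eq_inner inner_diff_left[of "x - z" "a *\<^sub>R H \<omega>"]
        inner_diff_right[of _ "x - z" "a *\<^sub>R H \<omega>"]
      by (simp add: inner_commute[of "H \<omega>" "x - z"] power2_eq_square)
    also have "\<dots> = ?P\<^sup>2 - 2 * a * ((x - z) \<bullet> Q \<omega>) + a * (2 * ((x - z) \<bullet> (Q \<omega> - H \<omega>)))
        + a\<^sup>2 * (norm (H \<omega>))\<^sup>2"
      by (simp add: inner_diff_right right_diff_distrib)
    also have "\<dots> \<le> ?P\<^sup>2 - 2 * a * ((x - z) \<bullet> Q \<omega>)
        + a * (\<sigma> / C\<^sub>g * (?P * G \<omega>)\<^sup>2 + (L\<^sub>f * ?E)\<^sup>2 / (\<sigma> / C\<^sub>g)) + a\<^sup>2 * (norm (H \<omega>))\<^sup>2"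
      using a cross by (intro add_right_mono add_left_mono mult_left_mono) auto
    also have "\<dots> = u \<omega>"
      by (simp add: u_def power_mult_distrib distrib_left mult_ac)
    finally show ?case .
  qed
  show int2: "integrable M (\<lambda>\<omega>. (norm (x' \<omega> - z))\<^sup>2)"
    by (rule Bochner_Integration.integrable_bound[OF u_int]) (use le in auto)
  have "expectation (\<lambda>\<omega>. (norm (x' \<omega> - z))\<^sup>2) \<le> expectation u"
    by (rule integral_mono_AE[OF int2 u_int le])
  also have "\<dots> = (norm (x - z))\<^sup>2 - 2 * a * ((x - z) \<bullet> expectation Q)
      + a * \<sigma> * (norm (x - z))\<^sup>2 / C\<^sub>g * expectation (\<lambda>\<omega>. (G \<omega>)\<^sup>2)
      + a\<^sup>2 * expectation (\<lambda>\<omega>. (norm (H \<omega>))\<^sup>2)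
      + a * L\<^sub>f\<^sup>2 * C\<^sub>g / \<sigma> * expectation (\<lambda>\<omega>. (norm (Y \<omega> - g x))\<^sup>2)"
    unfolding u_def[abs_def] using H2 Q1 G2 Y2 by (simp add: prob_space)
  also have "\<dots> \<le> (norm (x - z))\<^sup>2 - 2 * a * ((f \<circ> g) x - (f \<circ> g) z)
      + a * \<sigma> * (norm (x - z))\<^sup>2 / C\<^sub>g * C\<^sub>g + a\<^sup>2 * (C\<^sub>f * C\<^sub>g)
      + a * L\<^sub>f\<^sup>2 * C\<^sub>g / \<sigma> * ((1 - b)\<^sup>2 * (norm (y - g x))\<^sup>2 + b\<^sup>2 * V\<^sub>g)"
    using a \<sigma> constants_pos H2 G2 Y2_le expected_sample_gradient[OF x, of z, folded Q_def[abs_def]]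
    by (intro add_mono diff_mono mult_left_mono) auto
  finally show "expectation (\<lambda>\<omega>. (norm (x' \<omega> - z))\<^sup>2)
      \<le> (norm (x - z))\<^sup>2 - 2 * a * ((f \<circ> g) x - (f \<circ> g) z) + a * \<sigma> * (norm (x - z))\<^sup>2
        + a\<^sup>2 * (C\<^sub>f * C\<^sub>g)
        + a * L\<^sub>f\<^sup>2 * C\<^sub>g / \<sigma> * ((1 - b)\<^sup>2 * (norm (y - g x))\<^sup>2 + b\<^sup>2 * V\<^sub>g)"
    using constants_pos by simp
qed

end

subsection \<open>Independence of iterates and fresh samples\<close>

context scgd_problem
begin

text \<open>Keeping the sample as an argument separate from the state makes it possible to exchange
  a fresh sample for one with the law of \<open>sample 0\<close>.\<close>

definition sample_step ::
  "real \<Rightarrow> real \<Rightarrow> ((real^'n) \<times> (real^'m)) \<times> ('w \<times> 'v) \<Rightarrow> (real^'n) \<times> (real^'m)" where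
  "sample_step a b = (\<lambda>((x, y), (\<xi>, \<zeta>)).
     let y' = (1 - b) *\<^sub>R y + b *\<^sub>R g\<^sub>w \<xi> x
     in (closest_point X (x - a *\<^sub>R (Gw \<xi> x *v gradient (f\<^sub>v \<zeta>) y')), y'))"

text \<open>The first component lives on \<open>X\<close> with the trace sigma-algebra, since the
  sampled functions are assumed measurable only there.\<close>

abbreviation "state_space \<equiv> restrict_space borel X \<Otimes>\<^sub>M (borel :: (real^'m) measure)"

lemma measurable_state_fst: "fst \<in> borel_measurable state_space"
  using measurable_fst[of "restrict_space borel X" "borel :: (real^'m) measure"]
  unfolding measurable_restrict_space2_iff by blast

lemma measurable_sample_step [measurable]:
  "sample_step a b \<in> state_space \<Otimes>\<^sub>M (W \<Otimes>\<^sub>M V) \<rightarrow>\<^sub>M state_space"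
proof -
  let ?N = "state_space \<Otimes>\<^sub>M (W \<Otimes>\<^sub>M V)"
  have pair: "(\<lambda>p. (fst (snd p), fst (fst p))) \<in> ?N \<rightarrow>\<^sub>M W \<Otimes>\<^sub>M restrict_space borel X"
    by measurable
  have [measurable]: "(\<lambda>p. g\<^sub>w (fst (snd p)) (fst (fst p))) \<in> borel_measurable ?N"
    using measurable_compose[OF pair g\<^sub>w_measurable] by simp
  have [measurable]: "(\<lambda>p. Gw (fst (snd p)) (fst (fst p))) \<in> borel_measurable ?N"
    using measurable_compose[OF pair Gw_measurable] by simp
  have [measurable]: "(\<lambda>p. fst (fst p)) \<in> borel_measurable ?N"
    by (rule measurable_compose[OF measurable_fst measurable_state_fst])
  define y' where "y' p = (1 - b) *\<^sub>R snd (fst p) + b *\<^sub>R g\<^sub>w (fst (snd p)) (fst (fst p))"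
    for p :: "((real^'n) \<times> (real^'m)) \<times> ('w \<times> 'v)"
  have [measurable]: "y' \<in> borel_measurable ?N" unfolding y'_def by measurable
  define x' where "x' p = closest_point X
      (fst (fst p) - a *\<^sub>R (Gw (fst (snd p)) (fst (fst p)) *v gradient (f\<^sub>v (snd (snd p))) (y' p)))" for p
  have "x' \<in> borel_measurable ?N" unfolding x'_def by measurable
  \<comment> \<open>The projection has values in \<open>X\<close>, so the step maps the state space
    into itself and can be iterated.\<close>
  then have [measurable]: "x' \<in> ?N \<rightarrow>\<^sub>M restrict_space borel X"
    using closest_point_in_set[OF X_closed X_nonempty]
    by (intro measurable_restrict_space2) (auto simp: x'_def)
  have "sample_step a b = (\<lambda>p. (x' p, y' p))"
    by (auto simp: sample_step_def x'_def y'_def Let_def split_beta)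
  then show ?thesis by simp
qed

end

section \<open>The iterates as functions of the samples\<close>

locale scgd_iteration =
  scgd_problem M W V w v f\<^sub>v g\<^sub>w Gw f g X C\<^sub>g C\<^sub>f V\<^sub>g L\<^sub>f
  for M :: "'a measure" and W :: "'w measure" and V :: "'v measure"
    and w v
    and f\<^sub>v :: "'v \<Rightarrow> real^'m \<Rightarrow> real"
    and g\<^sub>w :: "'w \<Rightarrow> real^'n \<Rightarrow> real^'m"
    and Gw f g X C\<^sub>g C\<^sub>f V\<^sub>g L\<^sub>f +
  fixes \<alpha> \<beta> :: "nat \<Rightarrow> real" and x\<^sub>0 :: "real^'n" and y\<^sub>0 :: "real^'m"
    and x :: "nat \<Rightarrow> 'a \<Rightarrow> real^'n" and y :: "nat \<Rightarrow> 'a \<Rightarrow> real^'m"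
  assumes x0_in_X: "x\<^sub>0 \<in> X"
    and scgd: "basic_scgd M w v f\<^sub>v g\<^sub>w Gw X \<alpha> \<beta> x\<^sub>0 y\<^sub>0 x y"
begin

text \<open>The iterates as deterministic functions of a sample sequence. Only the entries before k
  matter, which is what makes the state at time k independent of sample k.\<close>

primrec state :: "nat \<Rightarrow> (nat \<Rightarrow> 'w \<times> 'v) \<Rightarrow> (real^'n) \<times> (real^'m)" where
  "state 0 s = (x\<^sub>0, y\<^sub>0)"
| "state (Suc k) s = sample_step (\<alpha> k) (\<beta> k) (state k s, s k)"

abbreviation "sample k \<omega> \<equiv> (w k \<omega>, v k \<omega>)"

lemma state_eq_iterates:
  assumes "\<omega> \<in> space M"
  shows "state k (\<lambda>j. sample j \<omega>) = (x k \<omega>, y k \<omega>)"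
  using scgd assms
  by (induction k) (auto simp: basic_scgd_def sample_step_def Let_def)

lemma iterates_Suc:
  assumes "\<omega> \<in> space M"
  shows "(x (Suc k) \<omega>, y (Suc k) \<omega>) = sample_step (\<alpha> k) (\<beta> k) ((x k \<omega>, y k \<omega>), sample k \<omega>)"
  using state_eq_iterates[OF assms, of "Suc k"] state_eq_iterates[OF assms, of k] by simp

lemma state_restrict:
  assumes "{..<k} \<subseteq> I"
  shows "state k (restrict s I) = state k s"
  using assms by (induction k) (auto simp: lessThan_Suc)

lemma measurable_state:
  assumes "{..<k} \<subseteq> I"
  shows "state k \<in> PiM I (\<lambda>_. W \<Otimes>\<^sub>M V) \<rightarrow>\<^sub>M state_space"
  using assms
proof (induction k)
  case 0
  have "(x\<^sub>0, y\<^sub>0) \<in> space state_space"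
    using x0_in_X by (simp add: space_pair_measure space_restrict_space)
  then show ?case by simp
next
  case (Suc k)
  then have [measurable]: "state k \<in> PiM I (\<lambda>_. W \<Otimes>\<^sub>M V) \<rightarrow>\<^sub>M state_space" "k \<in> I"
    by (simp_all add: lessThan_Suc)
  show ?case by simp
qed

lemma measurable_sample [measurable]: "sample k \<in> M \<rightarrow>\<^sub>M W \<Otimes>\<^sub>M V"
  by measurable

text \<open>\<open>basic_scgd\<close> prescribes only values of the iterates; their measurability is
  obtained by writing them as the measurable map \<open>state k\<close> of the first k samples.
  Membership of \<open>x k\<close> in \<open>X\<close> then comes with the target space.\<close>

lemma measurable_iterates: "(\<lambda>\<omega>. (x k \<omega>, y k \<omega>)) \<in> M \<rightarrow>\<^sub>M state_space"
proof -
  have "(\<lambda>\<omega>. state k (restrict (\<lambda>j. sample j \<omega>) {..<k})) \<in> M \<rightarrow>\<^sub>M state_space"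
    by (rule measurable_compose[OF _ measurable_state[OF order_refl]])
       (intro measurable_restrict measurable_sample)
  then show ?thesis
    by (simp add: state_restrict state_eq_iterates cong: measurable_cong)
qed

lemma x_in_X: "\<omega> \<in> space M \<Longrightarrow> x k \<omega> \<in> X"
  using measurable_space[OF measurable_iterates]
  by (auto simp: space_pair_measure space_restrict_space)

lemma borel_measurable_iterates [measurable]:
  "x k \<in> borel_measurable M" "y k \<in> borel_measurable M"
  using measurable_compose[OF measurable_iterates measurable_state_fst]
    measurable_compose[OF measurable_iterates measurable_snd] by simp_all

text \<open>Samples with index below k and the sample with index k form independent blocks, so their
  joint law is a product and Tonelli applies; identical distribution then moves the inner sample to
  index 0, where all moment assumptions are stated.\<close>

lemma nn_integral_fresh_sample:
  assumes \<Phi>: "\<Phi> \<in> borel_measurable (state_space \<Otimes>\<^sub>M (W \<Otimes>\<^sub>M V))"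
  shows "(\<integral>\<^sup>+\<omega>. \<Phi> ((x k \<omega>, y k \<omega>), sample k \<omega>) \<partial>M)
    = (\<integral>\<^sup>+\<omega>. \<integral>\<^sup>+\<omega>'. \<Phi> ((x k \<omega>, y k \<omega>), sample 0 \<omega>') \<partial>M \<partial>M)"
proof -
  let ?P = "W \<Otimes>\<^sub>M V"
  let ?A = "PiM {..<k} (\<lambda>_. ?P)" and ?B = "PiM {k} (\<lambda>_. ?P)"
  \<comment> \<open>\<open>now\<close> is a family over the singleton index set, matching the form
    in which independence of blocks of a family is stated.\<close>
  define past now where "past \<omega> = (\<lambda>j\<in>{..<k}. sample j \<omega>)" and "now \<omega> = (\<lambda>j\<in>{k}. sample j \<omega>)" for \<omega>
  note [measurable] = \<Phi> measurable_state[OF order_refl]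
  have state: "state k (past \<omega>) = (x k \<omega>, y k \<omega>)" if "\<omega> \<in> space M" for \<omega>
    using that by (simp add: past_def state_restrict state_eq_iterates)
  have now: "now \<omega> k = sample k \<omega>" for \<omega>
    by (simp add: now_def)
  have "indep_var ?A past ?B now"
    unfolding past_def[abs_def] now_def[abs_def]
    by (rule indep_var_restrict[OF samples_indep]) auto
  then have [measurable]: "past \<in> M \<rightarrow>\<^sub>M ?A" "now \<in> M \<rightarrow>\<^sub>M ?B"
    and prod: "distr M (?A \<Otimes>\<^sub>M ?B) (\<lambda>\<omega>. (past \<omega>, now \<omega>)) = distr M ?A past \<Otimes>\<^sub>M distr M ?B now"
    unfolding indep_var_distribution_eq by simp_all
  interpret D: prob_space "distr M ?B now"
    by (rule prob_space_distr) simp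
  have [measurable]: "(\<lambda>t. t k) \<in> ?B \<rightarrow>\<^sub>M ?P"
    by (rule measurable_component_singleton) simp
  have \<Psi> [measurable]: "(\<lambda>(s, t). \<Phi> (state k s, t k)) \<in> borel_measurable (?A \<Otimes>\<^sub>M ?B)"
    by measurable
  have "(\<integral>\<^sup>+\<omega>. \<Phi> ((x k \<omega>, y k \<omega>), sample k \<omega>) \<partial>M) = (\<integral>\<^sup>+\<omega>. \<Phi> (state k (past \<omega>), now \<omega> k) \<partial>M)"
    by (intro nn_integral_cong) (simp add: state now)
  also have "\<dots> = (\<integral>\<^sup>+(s, t). \<Phi> (state k s, t k) \<partial>distr M (?A \<Otimes>\<^sub>M ?B) (\<lambda>\<omega>. (past \<omega>, now \<omega>)))"
    by (subst nn_integral_distr) auto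
  also have "\<dots> = (\<integral>\<^sup>+s. \<integral>\<^sup>+t. \<Phi> (state k s, t k) \<partial>distr M ?B now \<partial>distr M ?A past)"
    unfolding prod by (subst D.nn_integral_fst[symmetric]) auto
  also have "\<dots> = (\<integral>\<^sup>+\<omega>. \<integral>\<^sup>+t. \<Phi> (state k (past \<omega>), t k) \<partial>distr M ?B now \<partial>M)"
    by (subst nn_integral_distr) auto
  also have "\<dots> = (\<integral>\<^sup>+\<omega>. \<integral>\<^sup>+\<omega>'. \<Phi> ((x k \<omega>, y k \<omega>), sample 0 \<omega>') \<partial>M \<partial>M)"
  \<comment> \<open>With the state frozen, the inner integral depends only on the law of the sample,
    which is the same for k and 0.\<close>
  proof (intro nn_integral_cong)
    fix \<omega> assume \<omega>: "\<omega> \<in> space M"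
    have sp: "(x k \<omega>, y k \<omega>) \<in> space state_space"
      using measurable_iterates \<omega> by (rule measurable_space)
    have [measurable]: "(\<lambda>q. \<Phi> ((x k \<omega>, y k \<omega>), q)) \<in> borel_measurable ?P"
      by (rule measurable_compose[OF measurable_Pair1'[OF sp] \<Phi>])
    have "(\<integral>\<^sup>+t. \<Phi> (state k (past \<omega>), t k) \<partial>distr M ?B now)
        = (\<integral>\<^sup>+\<omega>'. \<Phi> ((x k \<omega>, y k \<omega>), sample k \<omega>') \<partial>M)"
      using \<omega> by (simp add: state now nn_integral_distr)
    also have "\<dots> = (\<integral>\<^sup>+q. \<Phi> ((x k \<omega>, y k \<omega>), q) \<partial>distr M ?P (sample k))"
      by (simp add: nn_integral_distr)
    also have "\<dots> = (\<integral>\<^sup>+\<omega>'. \<Phi> ((x k \<omega>, y k \<omega>), sample 0 \<omega>') \<partial>M)"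
      unfolding samples_identically_distributed[of k] by (simp add: nn_integral_distr)
    finally show "(\<integral>\<^sup>+t. \<Phi> (state k (past \<omega>), t k) \<partial>distr M ?B now) = \<dots>" .
  qed
  finally show ?thesis .
qed

text \<open>Transfers a bound \<open>u\<close> that holds at every fixed state to the iterates.
  Nonnegativity of \<open>u\<close> on \<open>X\<close> comes from that of \<open>h\<close>, so the
  \<open>ennreal\<close> computation can be read back as one of real expectations.\<close>

lemma
  fixes h :: "((real^'n) \<times> (real^'m)) \<times> ('w \<times> 'v) \<Rightarrow> real"
  assumes h: "h \<in> borel_measurable (state_space \<Otimes>\<^sub>M (W \<Otimes>\<^sub>M V))" and h_nonneg: "\<And>p. h p \<ge> 0"
    and fixed: "\<And>p q. p \<in> X \<Longrightarrow> integrable M (\<lambda>\<omega>. h ((p, q), sample 0 \<omega>))"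
      "\<And>p q. p \<in> X \<Longrightarrow> expectation (\<lambda>\<omega>. h ((p, q), sample 0 \<omega>)) \<le> u p q"
    and u: "integrable M (\<lambda>\<omega>. u (x k \<omega>) (y k \<omega>))"
  shows integrable_fresh_sample: "integrable M (\<lambda>\<omega>. h ((x k \<omega>, y k \<omega>), sample k \<omega>))"
    and expectation_fresh_sample_le: "expectation (\<lambda>\<omega>. h ((x k \<omega>, y k \<omega>), sample k \<omega>))
      \<le> expectation (\<lambda>\<omega>. u (x k \<omega>) (y k \<omega>))"
proof -
  note [measurable] = h
  have inner: "(\<integral>\<^sup>+\<omega>'. ennreal (h ((p, q), sample 0 \<omega>')) \<partial>M) \<le> ennreal (u p q)" and u_nonneg: "u p q \<ge> 0"
    if "p \<in> X" for p q
  proof -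
    have "0 \<le> expectation (\<lambda>\<omega>. h ((p, q), sample 0 \<omega>))"
      by (simp add: h_nonneg)
    then show "u p q \<ge> 0" using fixed(2)[OF that, of q] by linarith
    show "(\<integral>\<^sup>+\<omega>'. ennreal (h ((p, q), sample 0 \<omega>')) \<partial>M) \<le> ennreal (u p q)"
      using fixed[OF that, of q] h_nonneg
      by (subst nn_integral_eq_integral) (auto intro: ennreal_leI)
  qed
  have u_AE: "AE \<omega> in M. 0 \<le> u (x k \<omega>) (y k \<omega>)"
    by (auto intro: u_nonneg x_in_X)
  have "(\<integral>\<^sup>+\<omega>. ennreal (h ((x k \<omega>, y k \<omega>), sample k \<omega>)) \<partial>M)
      \<le> (\<integral>\<^sup>+\<omega>. ennreal (u (x k \<omega>) (y k \<omega>)) \<partial>M)"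
    by (subst nn_integral_fresh_sample) (auto intro!: nn_integral_mono inner x_in_X)
  also have "\<dots> = ennreal (expectation (\<lambda>\<omega>. u (x k \<omega>) (y k \<omega>)))"
    using u u_AE by (rule nn_integral_eq_integral)
  finally have "(\<integral>\<^sup>+\<omega>. ennreal (h ((x k \<omega>, y k \<omega>), sample k \<omega>)) \<partial>M) \<le> \<dots>" .
  moreover have "(\<lambda>\<omega>. h ((x k \<omega>, y k \<omega>), sample k \<omega>)) \<in> borel_measurable M"
    by (rule measurable_compose[OF measurable_Pair[OF measurable_iterates measurable_sample] h])
  moreover have "0 \<le> expectation (\<lambda>\<omega>. u (x k \<omega>) (y k \<omega>))"
    by (rule integral_nonneg_AE[OF u_AE])
  ultimately show "integrable M (\<lambda>\<omega>. h ((x k \<omega>, y k \<omega>), sample k \<omega>))"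
    "expectation (\<lambda>\<omega>. h ((x k \<omega>, y k \<omega>), sample k \<omega>)) \<le> expectation (\<lambda>\<omega>. u (x k \<omega>) (y k \<omega>))"
    using h_nonneg by (auto intro!: integrable_expectation_le_of_nn_integral)
qed

end

subsection \<open>Rates of the iterates\<close>

context scgd_iteration
begin

text \<open>The preceding transfer specialized to quantities comparing the next state with the
  current one, such as displacements; the current state is recovered as the first component of the
  pair fed to \<open>sample_step\<close>.\<close>

lemma
  fixes h :: "(real^'n) \<times> (real^'m) \<Rightarrow> (real^'n) \<times> (real^'m) \<Rightarrow> real"
  assumes h: "(\<lambda>(s', s). h s' s) \<in> borel_measurable (state_space \<Otimes>\<^sub>M state_space)"
    and h_nonneg: "\<And>s' s. h s' s \<ge> 0"
    and fixed: "\<And>p q. p \<in> X \<Longrightarrow>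
        integrable M (\<lambda>\<omega>. h (sample_step (\<alpha> k) (\<beta> k) ((p, q), sample 0 \<omega>)) (p, q))"
      "\<And>p q. p \<in> X \<Longrightarrow>
        expectation (\<lambda>\<omega>. h (sample_step (\<alpha> k) (\<beta> k) ((p, q), sample 0 \<omega>)) (p, q)) \<le> u p q"
    and u: "integrable M (\<lambda>\<omega>. u (x k \<omega>) (y k \<omega>))"
  shows integrable_step: "integrable M (\<lambda>\<omega>. h (x (Suc k) \<omega>, y (Suc k) \<omega>) (x k \<omega>, y k \<omega>))"
    and expectation_step_le: "expectation (\<lambda>\<omega>. h (x (Suc k) \<omega>, y (Suc k) \<omega>) (x k \<omega>, y k \<omega>))
      \<le> expectation (\<lambda>\<omega>. u (x k \<omega>) (y k \<omega>))"
proof -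
  let ?h = "\<lambda>p. h (sample_step (\<alpha> k) (\<beta> k) p) (fst p)"
  have h': "?h \<in> borel_measurable (state_space \<Otimes>\<^sub>M (W \<Otimes>\<^sub>M V))"
    using measurable_compose[OF measurable_Pair[OF measurable_sample_step measurable_fst] h] by simp
  have "integrable M (\<lambda>\<omega>. ?h ((x k \<omega>, y k \<omega>), sample k \<omega>))"
    by (rule integrable_fresh_sample[OF h' _ _ _ u]) (use h_nonneg fixed in auto)
  then show "integrable M (\<lambda>\<omega>. h (x (Suc k) \<omega>, y (Suc k) \<omega>) (x k \<omega>, y k \<omega>))"
    by (simp add: iterates_Suc cong: Bochner_Integration.integrable_cong)
  have "expectation (\<lambda>\<omega>. ?h ((x k \<omega>, y k \<omega>), sample k \<omega>)) \<le> expectation (\<lambda>\<omega>. u (x k \<omega>) (y k \<omega>))"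
    by (rule expectation_fresh_sample_le[OF h' _ _ _ u]) (use h_nonneg fixed in auto)
  then show "expectation (\<lambda>\<omega>. h (x (Suc k) \<omega>, y (Suc k) \<omega>) (x k \<omega>, y k \<omega>))
      \<le> expectation (\<lambda>\<omega>. u (x k \<omega>) (y k \<omega>))"
    by (simp add: iterates_Suc cong: Bochner_Integration.integral_cong)
qed

lemma
  assumes "\<alpha> k \<ge> 0"
  shows integrable_displacement: "integrable M (\<lambda>\<omega>. (norm (x (Suc k) \<omega> - x k \<omega>))\<^sup>2)"
    and expected_displacement:
      "expectation (\<lambda>\<omega>. (norm (x (Suc k) \<omega> - x k \<omega>))\<^sup>2) \<le> (\<alpha> k)\<^sup>2 * (C\<^sub>f * C\<^sub>g)"
proof -
  let ?h = "\<lambda>s' s :: (real^'n) \<times> (real^'m). (norm (fst s' - fst s))\<^sup>2"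
  note [measurable] = measurable_state_fst
  have h: "(\<lambda>(s', s). ?h s' s) \<in> borel_measurable (state_space \<Otimes>\<^sub>M state_space)" by measurable
  \<comment> \<open>The one-step estimates are instantiated with \<open>\<sigma> = 1\<close> and, in
    \<open>fixed'\<close>, with the comparison point \<open>p\<close> itself.\<close>
  note fixed = integrable_projected_displacement[OF _ _ assms zero_less_one]
    projected_displacement[OF _ _ assms zero_less_one]
  have fixed': "integrable M (\<lambda>\<omega>. ?h (sample_step (\<alpha> k) (\<beta> k) ((p, q), sample 0 \<omega>)) (p, q))"
    "expectation (\<lambda>\<omega>. ?h (sample_step (\<alpha> k) (\<beta> k) ((p, q), sample 0 \<omega>)) (p, q))
      \<le> (\<alpha> k)\<^sup>2 * (C\<^sub>f * C\<^sub>g)"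
    if "p \<in> X" for p q
    using fixed[OF that that, of "\<beta> k" q] by (simp_all add: sample_step_def Let_def)
  show "integrable M (\<lambda>\<omega>. (norm (x (Suc k) \<omega> - x k \<omega>))\<^sup>2)"
    using integrable_step[OF h _ fixed'] by simp
  show "expectation (\<lambda>\<omega>. (norm (x (Suc k) \<omega> - x k \<omega>))\<^sup>2) \<le> (\<alpha> k)\<^sup>2 * (C\<^sub>f * C\<^sub>g)"
    using expectation_step_le[OF h _ fixed'] by (simp add: prob_space)
qed

lemma
  assumes int: "integrable M (\<lambda>\<omega>. (norm (y k \<omega> - g (x k \<omega>)))\<^sup>2)"
  shows integrable_tracking_step: "integrable M (\<lambda>\<omega>. (norm (y (Suc k) \<omega> - g (x k \<omega>)))\<^sup>2)"
    and expected_tracking_step: "expectation (\<lambda>\<omega>. (norm (y (Suc k) \<omega> - g (x k \<omega>)))\<^sup>2)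
      \<le> (1 - \<beta> k)\<^sup>2 * expectation (\<lambda>\<omega>. (norm (y k \<omega> - g (x k \<omega>)))\<^sup>2) + (\<beta> k)\<^sup>2 * V\<^sub>g"
proof -
  let ?h = "\<lambda>s' s :: (real^'n) \<times> (real^'m). (norm (snd s' - g (fst s)))\<^sup>2"
  note [measurable] = measurable_state_fst
  have h: "(\<lambda>(s', s). ?h s' s) \<in> borel_measurable (state_space \<Otimes>\<^sub>M state_space)" by measurable
  have fixed': "integrable M (\<lambda>\<omega>. ?h (sample_step (\<alpha> k) (\<beta> k) ((p, q), sample 0 \<omega>)) (p, q))"
    "expectation (\<lambda>\<omega>. ?h (sample_step (\<alpha> k) (\<beta> k) ((p, q), sample 0 \<omega>)) (p, q))
      \<le> (1 - \<beta> k)\<^sup>2 * (norm (q - g p))\<^sup>2 + (\<beta> k)\<^sup>2 * V\<^sub>g"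
    if "p \<in> X" for p q
    using integrable_tracking[OF that, of "\<beta> k" q] tracking_step[OF that, of "\<beta> k" q]
    by (simp_all add: sample_step_def Let_def)
  show "integrable M (\<lambda>\<omega>. (norm (y (Suc k) \<omega> - g (x k \<omega>)))\<^sup>2)"
    using integrable_step[OF h _ fixed'] int by simp
  show "expectation (\<lambda>\<omega>. (norm (y (Suc k) \<omega> - g (x k \<omega>)))\<^sup>2)
      \<le> (1 - \<beta> k)\<^sup>2 * expectation (\<lambda>\<omega>. (norm (y k \<omega> - g (x k \<omega>)))\<^sup>2) + (\<beta> k)\<^sup>2 * V\<^sub>g"
    using expectation_step_le[OF h _ fixed'] int by (simp add: prob_space)
qed

text \<open>The error is split at \<open>g (x k)\<close>: averaging noise on one side, drift of the
  target on the other, the latter controlled by the Lipschitz bound and the displacement. Young's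
  inequality with a free parameter \<open>\<eta>\<close> separates the squares;
  \<open>\<eta>\<close> is later taken to be \<open>\<beta> k\<close>.\<close>

lemma
  assumes a: "\<alpha> k \<ge> 0" and \<eta>: "\<eta> > 0"
    and int: "integrable M (\<lambda>\<omega>. (norm (y k \<omega> - g (x k \<omega>)))\<^sup>2)"
  shows integrable_tracking_error: "integrable M (\<lambda>\<omega>. (norm (y (Suc k) \<omega> - g (x (Suc k) \<omega>)))\<^sup>2)"
    and expected_tracking_error: "expectation (\<lambda>\<omega>. (norm (y (Suc k) \<omega> - g (x (Suc k) \<omega>)))\<^sup>2)
      \<le> (1 + \<eta>) * ((1 - \<beta> k)\<^sup>2 * expectation (\<lambda>\<omega>. (norm (y k \<omega> - g (x k \<omega>)))\<^sup>2) + (\<beta> k)\<^sup>2 * V\<^sub>g)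
        + (1 + 1 / \<eta>) * C\<^sub>g\<^sup>2 * ((\<alpha> k)\<^sup>2 * (C\<^sub>f * C\<^sub>g))"
proof -
  let ?u = "\<lambda>\<omega>. (1 + \<eta>) * (norm (y (Suc k) \<omega> - g (x k \<omega>)))\<^sup>2
    + (1 + 1 / \<eta>) * C\<^sub>g\<^sup>2 * (norm (x (Suc k) \<omega> - x k \<omega>))\<^sup>2"
  have u: "integrable M ?u"
    using integrable_tracking_step[OF int] integrable_displacement[OF a] by auto
  have le: "(norm (y (Suc k) \<omega> - g (x (Suc k) \<omega>)))\<^sup>2 \<le> ?u \<omega>" for \<omega>
  proof -
    define r t where "r = norm (y (Suc k) \<omega> - g (x k \<omega>))" and "t = norm (x (Suc k) \<omega> - x k \<omega>)"
    have "norm (y (Suc k) \<omega> - g (x (Suc k) \<omega>)) \<le> r + norm (g (x k \<omega>) - g (x (Suc k) \<omega>))"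
      unfolding r_def by (rule order_trans[OF _ norm_triangle_ineq]) simp
    also have "norm (g (x k \<omega>) - g (x (Suc k) \<omega>)) \<le> C\<^sub>g * t"
      using lipschitz_onD[OF g_lipschitz, of "x (Suc k) \<omega>" "x k \<omega>"]
      by (simp add: t_def dist_norm norm_minus_commute)
    finally have "(norm (y (Suc k) \<omega> - g (x (Suc k) \<omega>)))\<^sup>2 \<le> (r + C\<^sub>g * t)\<^sup>2"
      by (intro power_mono) simp_all
    also have "\<dots> \<le> (1 + \<eta>) * r\<^sup>2 + (1 + 1 / \<eta>) * (C\<^sub>g * t)\<^sup>2"
    proof -
      have "0 \<le> (\<eta> * r - C\<^sub>g * t)\<^sup>2 / \<eta>" using \<eta> by simp
      then show ?thesis using \<eta> by (simp add: power2_eq_square field_simps)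
    qed
    finally show ?thesis by (simp add: r_def t_def power_mult_distrib mult.assoc)
  qed
  show int': "integrable M (\<lambda>\<omega>. (norm (y (Suc k) \<omega> - g (x (Suc k) \<omega>)))\<^sup>2)"
    by (rule Bochner_Integration.integrable_bound[OF u])
       (use order_trans[OF le abs_ge_self] in auto)
  have "expectation (\<lambda>\<omega>. (norm (y (Suc k) \<omega> - g (x (Suc k) \<omega>)))\<^sup>2) \<le> expectation ?u"
    by (rule integral_mono[OF int' u le])
  also have "\<dots> = (1 + \<eta>) * expectation (\<lambda>\<omega>. (norm (y (Suc k) \<omega> - g (x k \<omega>)))\<^sup>2)
      + (1 + 1 / \<eta>) * C\<^sub>g\<^sup>2 * expectation (\<lambda>\<omega>. (norm (x (Suc k) \<omega> - x k \<omega>))\<^sup>2)"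
    using integrable_tracking_step[OF int] integrable_displacement[OF a] by simp
  also have "\<dots> \<le> (1 + \<eta>) * ((1 - \<beta> k)\<^sup>2 * expectation (\<lambda>\<omega>. (norm (y k \<omega> - g (x k \<omega>)))\<^sup>2) + (\<beta> k)\<^sup>2 * V\<^sub>g)
        + (1 + 1 / \<eta>) * C\<^sub>g\<^sup>2 * ((\<alpha> k)\<^sup>2 * (C\<^sub>f * C\<^sub>g))"
    using \<eta> expected_tracking_step[OF int] expected_displacement[OF a]
    by (intro add_mono mult_left_mono) auto
  finally show "expectation (\<lambda>\<omega>. (norm (y (Suc k) \<omega> - g (x (Suc k) \<omega>)))\<^sup>2) \<le> \<dots>" .
qed

lemma
  assumes a: "\<alpha> k \<ge> 0" and \<sigma>: "\<sigma> > 0" and z: "z \<in> X"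
    and strong: "\<And>p. p \<in> X \<Longrightarrow> \<sigma> * (norm (p - z))\<^sup>2 \<le> (f \<circ> g) p - (f \<circ> g) z"
    and int: "integrable M (\<lambda>\<omega>. (norm (y k \<omega> - g (x k \<omega>)))\<^sup>2)"
      "integrable M (\<lambda>\<omega>. (norm (x k \<omega> - z))\<^sup>2)"
  shows integrable_distance: "integrable M (\<lambda>\<omega>. (norm (x (Suc k) \<omega> - z))\<^sup>2)"
    and expected_distance: "expectation (\<lambda>\<omega>. (norm (x (Suc k) \<omega> - z))\<^sup>2)
      \<le> (1 - \<alpha> k * \<sigma>) * expectation (\<lambda>\<omega>. (norm (x k \<omega> - z))\<^sup>2) + (\<alpha> k)\<^sup>2 * (C\<^sub>f * C\<^sub>g)
        + \<alpha> k * L\<^sub>f\<^sup>2 * C\<^sub>g / \<sigma> *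
          ((1 - \<beta> k)\<^sup>2 * expectation (\<lambda>\<omega>. (norm (y k \<omega> - g (x k \<omega>)))\<^sup>2) + (\<beta> k)\<^sup>2 * V\<^sub>g)"
proof -
  let ?h = "\<lambda>s' s :: (real^'n) \<times> (real^'m). (norm (fst s' - z))\<^sup>2"
  let ?u = "\<lambda>p q. (1 - \<alpha> k * \<sigma>) * (norm (p - z))\<^sup>2 + (\<alpha> k)\<^sup>2 * (C\<^sub>f * C\<^sub>g)
    + \<alpha> k * L\<^sub>f\<^sup>2 * C\<^sub>g / \<sigma> * ((1 - \<beta> k)\<^sup>2 * (norm (q - g p))\<^sup>2 + (\<beta> k)\<^sup>2 * V\<^sub>g)"
  note [measurable] = measurable_state_fst
  have h: "(\<lambda>(s', s). ?h s' s) \<in> borel_measurable (state_space \<Otimes>\<^sub>M state_space)" by measurable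
  have int_fixed: "integrable M (\<lambda>\<omega>. ?h (sample_step (\<alpha> k) (\<beta> k) ((p, q), sample 0 \<omega>)) (p, q))"
    if "p \<in> X" for p q
    using integrable_projected_step[OF that z a \<sigma>, of "\<beta> k" q]
    by (simp add: sample_step_def Let_def)
  have fixed: "expectation (\<lambda>\<omega>. ?h (sample_step (\<alpha> k) (\<beta> k) ((p, q), sample 0 \<omega>)) (p, q)) \<le> ?u p q"
    if "p \<in> X" for p q
  proof -
    \<comment> \<open>Doubled, this gain contributes \<open>-2 * \<alpha> k * \<sigma>\<close>; the
      error term costs \<open>\<alpha> k * \<sigma>\<close>, and the contraction factor
      \<open>1 - \<alpha> k * \<sigma>\<close> remains.\<close>
    have "\<alpha> k * (\<sigma> * (norm (p - z))\<^sup>2) \<le> \<alpha> k * ((f \<circ> g) p - (f \<circ> g) z)"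
      using strong[OF that] a by (rule mult_left_mono)
    then show ?thesis
      using projected_step[OF that z a \<sigma>, of "\<beta> k" q]
      by (simp add: sample_step_def Let_def left_diff_distrib)
  qed
  show "integrable M (\<lambda>\<omega>. (norm (x (Suc k) \<omega> - z))\<^sup>2)"
    using integrable_step[OF h _ int_fixed fixed] int by simp
  show "expectation (\<lambda>\<omega>. (norm (x (Suc k) \<omega> - z))\<^sup>2)
      \<le> (1 - \<alpha> k * \<sigma>) * expectation (\<lambda>\<omega>. (norm (x k \<omega> - z))\<^sup>2) + (\<alpha> k)\<^sup>2 * (C\<^sub>f * C\<^sub>g)
        + \<alpha> k * L\<^sub>f\<^sup>2 * C\<^sub>g / \<sigma> *
          ((1 - \<beta> k)\<^sup>2 * expectation (\<lambda>\<omega>. (norm (y k \<omega> - g (x k \<omega>)))\<^sup>2) + (\<beta> k)\<^sup>2 * V\<^sub>g)"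
    using expectation_step_le[OF h _ int_fixed fixed] int by (simp add: prob_space)
qed

text \<open>Square integrability starts from the constant initial state and is passed on by each
  step. The tracking error comes first because the distance step relies on it.\<close>

lemma
  assumes alpha_nonneg: "\<And>k. \<alpha> k \<ge> 0" and \<sigma>: "\<sigma> > 0" and z: "z \<in> X"
    and strong: "\<And>p. p \<in> X \<Longrightarrow> \<sigma> * (norm (p - z))\<^sup>2 \<le> (f \<circ> g) p - (f \<circ> g) z"
  shows integrable_tracking_all: "integrable M (\<lambda>\<omega>. (norm (y k \<omega> - g (x k \<omega>)))\<^sup>2)"
    and integrable_distance_all: "integrable M (\<lambda>\<omega>. (norm (x k \<omega> - z))\<^sup>2)"
proof -
  have init: "x 0 \<omega> = x\<^sub>0" "y 0 \<omega> = y\<^sub>0" if "\<omega> \<in> space M" for \<omega>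
    using scgd that by (auto simp: basic_scgd_def)
  show tracking: "integrable M (\<lambda>\<omega>. (norm (y k \<omega> - g (x k \<omega>)))\<^sup>2)" for k
  proof (induction k)
    case 0
    then show ?case by (simp add: init cong: Bochner_Integration.integrable_cong)
  next
    case (Suc k)
    then show ?case by (intro integrable_tracking_error[OF alpha_nonneg zero_less_one])
  qed
  show "integrable M (\<lambda>\<omega>. (norm (x k \<omega> - z))\<^sup>2)"
  proof (induction k)
    case 0
    then show ?case by (simp add: init cong: Bochner_Integration.integrable_cong)
  next
    case (Suc k)
    then show ?case by (intro integrable_distance[OF alpha_nonneg \<sigma> z strong tracking])
  qed
qed

section \<open>Solving the coupled recursions\<close>

lemma mean_square_error_rate:
  assumes \<sigma>: "\<sigma> > 0" and z: "z \<in> X"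
    and strong: "\<And>p. p \<in> X \<Longrightarrow> \<sigma> * (norm (p - z))\<^sup>2 \<le> (f \<circ> g) p - (f \<circ> g) z"
    and alpha0: "\<alpha> 0 \<ge> 0" and alpha: "\<And>k. k \<ge> 1 \<Longrightarrow> \<alpha> k = 1 / (real k * \<sigma>)"
    and beta: "\<And>k. k \<ge> 1 \<Longrightarrow> \<beta> k = 1 / (real k * \<sigma>) powr (2/3)"
  shows "\<exists>D>0. \<forall>k\<ge>1. expectation (\<lambda>\<omega>. (norm (x k \<omega> - z))\<^sup>2) \<le> D * real k powr (-2/3)"
proof -
  define e p where "e k = expectation (\<lambda>\<omega>. (norm (x k \<omega> - z))\<^sup>2)"
    and "p k = expectation (\<lambda>\<omega>. (norm (y k \<omega> - g (x k \<omega>)))\<^sup>2)" for k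
  have e_nonneg: "e k \<ge> 0" and p_nonneg: "p k \<ge> 0" for k
    by (simp_all add: e_def p_def)
  have alpha_nonneg: "\<alpha> k \<ge> 0" for k
    using alpha0 alpha[of k] \<sigma> by (cases "k = 0") auto
  note int = integrable_tracking_all[OF alpha_nonneg \<sigma> z strong]
    integrable_distance_all[OF alpha_nonneg \<sigma> z strong]
  define b where "b = 1 / \<sigma> powr (2/3)"
  have b: "b > 0" using \<sigma> by (simp add: b_def)
  have beta_eq: "\<beta> k = b * real k powr (-2/3)" if "k \<ge> 1" for k
    using that \<sigma> powr_minus_divide[of "real k" "2/3"] by (simp add: beta b_def powr_mult)
  have beta_sq: "(\<beta> k)\<^sup>2 = b\<^sup>2 * real k powr (-4/3)" if "k \<ge> 1" for k
    using that by (simp add: beta_eq power_mult_distrib powr_power)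
  \<comment> \<open>The drift term has exponent -2 + 2/3 = -4/3, the same as the variance term
    \<open>(\<beta> k)\<^sup>2\<close>.\<close>
  have alpha_sq: "(\<alpha> k)\<^sup>2 / \<beta> k = real k powr (-4/3) / (\<sigma>\<^sup>2 * b)" if "k \<ge> 1" for k
  proof -
    have "real k powr (-4/3) * (real k)\<^sup>2 = real k powr (-4/3) * real k powr 2"
      using that by simp
    also have "\<dots> = real k powr (2/3)"
      unfolding powr_add[symmetric] by simp
    finally have "real k powr (-4/3) * (real k)\<^sup>2 * real k powr (-2/3) = 1"
      using that by (simp flip: powr_add)
    then show ?thesis
      using that \<sigma> b by (simp add: alpha beta_eq field_simps)
  qed

  \<comment> \<open>The factors 2 come from \<open>1 + \<beta> k \<le> 2\<close> and
    \<open>1 + 1 / \<beta> k \<le> 2 / \<beta> k\<close>, valid once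
    \<open>\<beta> k \<le> 1\<close>.\<close>
  define K where "K = 2 * b\<^sup>2 * V\<^sub>g + 2 * C\<^sub>g\<^sup>2 * (C\<^sub>f * C\<^sub>g) / (\<sigma>\<^sup>2 * b)"
  have "eventually (\<lambda>k. b * real k powr (-2/3) \<le> 1) sequentially"
    using b by real_asymp
  then have p_rec: "eventually (\<lambda>k. p (Suc k) \<le> (1 - b * real k powr (-2/3)) * p k
      + K * real k powr (-4/3)) sequentially"
    using eventually_ge_at_top[of 1]
  proof eventually_elim
    case (elim k)
    note k = elim(2)
    let ?\<beta> = "\<beta> k"
    have \<beta>: "0 < ?\<beta>" "?\<beta> \<le> 1"
      using elim b by (auto simp: beta_eq)
    \<comment> \<open>With \<open>\<eta> = \<beta> k\<close>, Young's inequality uses up only one of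
      the two contraction factors \<open>1 - \<beta> k\<close>.\<close>
    have "(1 + ?\<beta>) * (1 - ?\<beta>)\<^sup>2 = (1 - ?\<beta>) * (1 - ?\<beta>\<^sup>2)"
      by (simp add: power2_eq_square algebra_simps)
    also have "\<dots> \<le> (1 - ?\<beta>) * 1" using \<beta> by (intro mult_left_mono) auto
    finally have 1: "(1 + ?\<beta>) * (1 - ?\<beta>)\<^sup>2 \<le> 1 - ?\<beta>" by simp
    have 2: "1 + 1 / ?\<beta> \<le> 2 / ?\<beta>" using \<beta> by (simp add: field_simps)
    have "p (Suc k) \<le> (1 + ?\<beta>) * ((1 - ?\<beta>)\<^sup>2 * p k + ?\<beta>\<^sup>2 * V\<^sub>g)
        + (1 + 1 / ?\<beta>) * C\<^sub>g\<^sup>2 * ((\<alpha> k)\<^sup>2 * (C\<^sub>f * C\<^sub>g))"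
      unfolding p_def by (rule expected_tracking_error[OF alpha_nonneg \<beta>(1) int(1)])
    also have "\<dots> = ((1 + ?\<beta>) * (1 - ?\<beta>)\<^sup>2) * p k + (1 + ?\<beta>) * (?\<beta>\<^sup>2 * V\<^sub>g)
        + (1 + 1 / ?\<beta>) * (C\<^sub>g\<^sup>2 * ((\<alpha> k)\<^sup>2 * (C\<^sub>f * C\<^sub>g)))"
      by (simp only: distrib_left mult.assoc)
    also have "\<dots> \<le> (1 - ?\<beta>) * p k + 2 * (?\<beta>\<^sup>2 * V\<^sub>g) + 2 / ?\<beta> * (C\<^sub>g\<^sup>2 * ((\<alpha> k)\<^sup>2 * (C\<^sub>f * C\<^sub>g)))"
      using 1 2 \<beta> p_nonneg constants_pos by (intro add_mono mult_right_mono) auto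
    also have "2 / ?\<beta> * (C\<^sub>g\<^sup>2 * ((\<alpha> k)\<^sup>2 * (C\<^sub>f * C\<^sub>g))) = 2 * C\<^sub>g\<^sup>2 * (C\<^sub>f * C\<^sub>g) * ((\<alpha> k)\<^sup>2 / ?\<beta>)"
      by simp
    finally show ?case
      unfolding alpha_sq[OF k] beta_sq[OF k] unfolding beta_eq[OF k] K_def
      by (simp add: algebra_simps)
  qed
  have "K \<ge> 0" using b constants_pos by (simp add: K_def)
  from damped_recursion_two_thirds[OF b this p_nonneg p_rec]
  obtain P where P: "P > 0" "\<And>k. k \<ge> 1 \<Longrightarrow> p k \<le> P * real k powr (-2/3)"
    by blast

  \<comment> \<open>The first summand is the noise of the direction; the second is the tracking
    error with its bound \<open>P\<close> inserted. Terms of order 1/k and k powr (-4/3) are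
    weakened to k powr (-2/3).\<close>
  define E where "E = C\<^sub>f * C\<^sub>g / \<sigma>\<^sup>2 + L\<^sub>f\<^sup>2 * C\<^sub>g / \<sigma>\<^sup>2 * ((1 + b)\<^sup>2 * P + b\<^sup>2 * V\<^sub>g)"
  have e_rec: "real k * e (Suc k) \<le> real (k - 1) * e k + E * real k powr (-2/3)" if k: "k \<ge> 1" for k
  proof -
    let ?r = "real k powr (-2/3)"
    have r: "real k powr (-1) \<le> ?r" "real k powr (-4/3) \<le> ?r" "?r \<le> real k powr 0"
      using k by (intro powr_mono; simp)+
    have "b * ?r \<le> b * 1" "0 \<le> b * ?r"
      using r(3) k b by (auto intro!: mult_left_mono)
    \<comment> \<open>This recursion must hold for every k from 1 on, where \<open>\<beta> k\<close>
      may exceed 1, so \<open>1 - \<beta> k\<close> is bounded only in absolute value.\<close>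
    then have "\<bar>1 - \<beta> k\<bar> \<le> 1 + b"
      unfolding beta_eq[OF k] using b by linarith
    then have "(1 - \<beta> k)\<^sup>2 \<le> (1 + b)\<^sup>2" 
      by (rule power2_le_iff_abs_le[THEN iffD2, rotated]) (use b in simp)
    then have "(1 - \<beta> k)\<^sup>2 * p k \<le> (1 + b)\<^sup>2 * (P * ?r)"
      using P(2)[OF k] p_nonneg by (intro mult_mono) auto
    moreover have "(\<beta> k)\<^sup>2 * V\<^sub>g \<le> b\<^sup>2 * ?r * V\<^sub>g"
      using r k constants_pos by (intro mult_right_mono) (auto simp: beta_sq mult_left_mono)
    ultimately have track: "(1 - \<beta> k)\<^sup>2 * p k + (\<beta> k)\<^sup>2 * V\<^sub>g \<le> ((1 + b)\<^sup>2 * P + b\<^sup>2 * V\<^sub>g) * ?r"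
      by (simp add: algebra_simps)
    have "real k * e (Suc k) \<le> real k * ((1 - \<alpha> k * \<sigma>) * e k + (\<alpha> k)\<^sup>2 * (C\<^sub>f * C\<^sub>g)
        + \<alpha> k * L\<^sub>f\<^sup>2 * C\<^sub>g / \<sigma> * ((1 - \<beta> k)\<^sup>2 * p k + (\<beta> k)\<^sup>2 * V\<^sub>g))"
      unfolding e_def p_def
      by (intro mult_left_mono expected_distance[OF alpha_nonneg \<sigma> z strong int]) auto
    also have "\<dots> = (real k - 1) * e k + C\<^sub>f * C\<^sub>g / \<sigma>\<^sup>2 * (1 / real k)
        + L\<^sub>f\<^sup>2 * C\<^sub>g / \<sigma>\<^sup>2 * ((1 - \<beta> k)\<^sup>2 * p k + (\<beta> k)\<^sup>2 * V\<^sub>g)"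
    proof -
      \<comment> \<open>The step size turns k (1 - \<alpha> k \<sigma>) into k - 1. The free
        variables t, c, s stand for the expectations and constants, so the identity is purely
        algebraic.\<close>
      have "real k * ((1 - \<alpha> k * \<sigma>) * t + (\<alpha> k)\<^sup>2 * c + \<alpha> k * L\<^sub>f\<^sup>2 * C\<^sub>g / \<sigma> * s)
          = (real k - 1) * t + c / \<sigma>\<^sup>2 * (1 / real k) + L\<^sub>f\<^sup>2 * C\<^sub>g / \<sigma>\<^sup>2 * s" for t c s
        using k \<sigma> by (simp add: alpha power2_eq_square field_simps)
      then show ?thesis .
    qed
    also have "\<dots> \<le> (real k - 1) * e k + C\<^sub>f * C\<^sub>g / \<sigma>\<^sup>2 * ?r
        + L\<^sub>f\<^sup>2 * C\<^sub>g / \<sigma>\<^sup>2 * (((1 + b)\<^sup>2 * P + b\<^sup>2 * V\<^sub>g) * ?r)"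
      using track r k constants_pos
      by (intro add_mono mult_left_mono) (auto simp: powr_minus_divide)
    finally show ?thesis using k by (simp add: E_def algebra_simps)
  qed
  have "E \<ge> 0" using P constants_pos by (simp add: E_def)
  from weighted_recursion_two_thirds[OF this e_nonneg e_rec] show ?thesis
    unfolding e_def .
qed

end

section \<open>Averages over the second half of the iterates\<close>

text \<open>The rounded-up half of k is \<open>(k + 1) div 2\<close>, so the window starts at an
  index that is positive and at least k/2; hence index 0 is never averaged and every index is
  comparable to k.\<close>

lemma half_window_bounds:
  assumes "k \<ge> 1"
  shows "half_window k \<ge> 1" "half_window k \<le> k" "k \<le> 2 * (k - half_window k + 1)"
proof -
  have eq: "half_window k = (k + 1) div 2"
    unfolding half_window_def by linarith
  show "half_window k \<ge> 1" "half_window k \<le> k" "k \<le> 2 * (k - half_window k + 1)"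
    using assms unfolding eq by presburger+
qed

text \<open>Convexity of the squared norm: the triangle inequality followed by Cauchy-Schwarz over
  the window, whose factor N cancels one of the two factors in N^2.\<close>

lemma norm_tail_average_diff_le:
  assumes "k \<ge> 1"
  shows "(norm (tail_average x k \<omega> - z))\<^sup>2
    \<le> (\<Sum>t = k - half_window k + 1..k. (norm (x t \<omega> - z))\<^sup>2) / real (half_window k)"
proof -
  let ?N = "half_window k" and ?I = "{k - half_window k + 1..k}"
  have N: "?N \<ge> 1" "card ?I = ?N" using half_window_bounds[OF assms] by auto
  have "tail_average x k \<omega> - z = (1 / real ?N) *\<^sub>R (\<Sum>t\<in>?I. x t \<omega> - z)"
    using N by (simp add: tail_average_def sum_subtractf scaleR_diff_right sum_constant_scaleR
        del: sum_constant)
  then have "(norm (tail_average x k \<omega> - z))\<^sup>2 = (norm (\<Sum>t\<in>?I. x t \<omega> - z))\<^sup>2 / (real ?N)\<^sup>2"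
    by (simp add: power_divide)
  also have "\<dots> \<le> (\<Sum>t\<in>?I. norm (x t \<omega> - z))\<^sup>2 / (real ?N)\<^sup>2"
    by (intro divide_right_mono power_mono norm_sum) auto
  also have "\<dots> \<le> ((\<Sum>t\<in>?I. (norm (x t \<omega> - z))\<^sup>2) * real (card ?I)) / (real ?N)\<^sup>2"
    by (intro divide_right_mono sum_squared_le_sum_of_squares) auto
  also have "\<dots> = (\<Sum>t\<in>?I. (norm (x t \<omega> - z))\<^sup>2) / real ?N"
    using N by (simp add: power2_eq_square)
  finally show ?thesis .
qed

text \<open>Every index of the window is at least k/2, so each summand obeys the rate at k up to the
  factor 2, and averaging preserves a common bound.\<close>

lemma (in prob_space)
  fixes x :: "nat \<Rightarrow> 'a \<Rightarrow> real^'n"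
  assumes meas: "\<And>t. x t \<in> borel_measurable M"
    and int: "\<And>t. integrable M (\<lambda>\<omega>. (norm (x t \<omega> - z))\<^sup>2)"
    and k: "k \<ge> 1"
  shows integrable_tail_average: "integrable M (\<lambda>\<omega>. (norm (tail_average x k \<omega> - z))\<^sup>2)"
    and tail_average_rate:
      "\<lbrakk>D \<ge> 0; \<And>t. t \<ge> 1 \<Longrightarrow> expectation (\<lambda>\<omega>. (norm (x t \<omega> - z))\<^sup>2) \<le> D * real t powr (-2/3)\<rbrakk>
        \<Longrightarrow> expectation (\<lambda>\<omega>. (norm (tail_average x k \<omega> - z))\<^sup>2) \<le> 2 * D * real k powr (-2/3)"
proof -
  let ?N = "half_window k" and ?I = "{k - half_window k + 1..k}"
  let ?u = "\<lambda>\<omega>. (\<Sum>t\<in>?I. (norm (x t \<omega> - z))\<^sup>2) / real ?N"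
  have N: "?N \<ge> 1" "card ?I = ?N" using half_window_bounds[OF k] by auto
  note [measurable] = meas
  have [measurable]: "tail_average x k \<in> borel_measurable M"
    unfolding tail_average_def[abs_def] by measurable
  have u: "integrable M ?u" using int by auto
  show int_avg: "integrable M (\<lambda>\<omega>. (norm (tail_average x k \<omega> - z))\<^sup>2)"
    by (rule Bochner_Integration.integrable_bound[OF u])
       (use order_trans[OF norm_tail_average_diff_le[OF k, of x _ z] abs_ge_self] in auto)
  assume D: "D \<ge> 0" and rate: "\<And>t. t \<ge> 1 \<Longrightarrow> expectation (\<lambda>\<omega>. (norm (x t \<omega> - z))\<^sup>2) \<le> D * real t powr (-2/3)"
  have each: "expectation (\<lambda>\<omega>. (norm (x t \<omega> - z))\<^sup>2) \<le> 2 * D * real k powr (-2/3)" if t: "t \<in> ?I" for t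
  proof -
    have "D * real t powr (-2/3) \<le> D * (2 * real k powr (-2/3))"
      using D half_window_bounds[OF k] t k
      by (intro mult_left_mono powr_neg_two_thirds_le_double) auto
    then show ?thesis using rate[of t] t by simp
  qed
  have "expectation (\<lambda>\<omega>. (norm (tail_average x k \<omega> - z))\<^sup>2) \<le> expectation ?u"
    by (rule integral_mono[OF int_avg u norm_tail_average_diff_le[OF k]])
  also have "\<dots> = (\<Sum>t\<in>?I. expectation (\<lambda>\<omega>. (norm (x t \<omega> - z))\<^sup>2)) / real ?N"
    using int by simp
  also have "\<dots> \<le> (\<Sum>t\<in>?I. 2 * D * real k powr (-2/3)) / real ?N"
    by (intro divide_right_mono sum_mono each) auto
  also have "\<dots> = 2 * D * real k powr (-2/3)"
    using N by simp
  finally show "expectation (\<lambda>\<omega>. (norm (tail_average x k \<omega> - z))\<^sup>2) \<le> \<dots>" .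
qed

theorem theorem7:
  fixes M :: "'a measure" and W :: "'w measure" and V :: "'v measure"
    and w :: "nat \<Rightarrow> 'a \<Rightarrow> 'w" and v :: "nat \<Rightarrow> 'a \<Rightarrow> 'v"
    and f\<^sub>v :: "'v \<Rightarrow> real^'m \<Rightarrow> real"
    and g\<^sub>w :: "'w \<Rightarrow> real^'n \<Rightarrow> real^'m"
    and Gw :: "'w \<Rightarrow> real^'n \<Rightarrow> real^'m^'n"
    and f :: "real^'m \<Rightarrow> real" and g :: "real^'n \<Rightarrow> real^'m"
    and X :: "(real^'n) set"
    and C\<^sub>g C\<^sub>f V\<^sub>g L\<^sub>f \<sigma> :: real
    and \<alpha> \<beta> :: "nat \<Rightarrow> real"
    and x\<^sub>0 x_opt :: "real^'n" and y\<^sub>0 :: "real^'m"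
    and x :: "nat \<Rightarrow> 'a \<Rightarrow> real^'n" and y :: "nat \<Rightarrow> 'a \<Rightarrow> real^'m"
  assumes problem: "scgd_problem M W V w v f\<^sub>v g\<^sub>w Gw f g X C\<^sub>g C\<^sub>f V\<^sub>g L\<^sub>f"
    and F_convex: "convex_on UNIV (f \<circ> g)"
    and sigma_pos: "\<sigma> > 0"
    and optimal: "x_opt \<in> X" "\<And>z. z \<in> X \<Longrightarrow> (f \<circ> g) x_opt \<le> (f \<circ> g) z"
    and strong_convexity:
      "\<And>z. z \<in> X \<Longrightarrow> (f \<circ> g) z - (f \<circ> g) x_opt \<ge> \<sigma> * (norm (z - x_opt))\<^sup>2"
    and x0: "x\<^sub>0 \<in> X"
    and initial_stepsizes: "0 < \<alpha> 0" "\<alpha> 0 \<le> 1" "0 < \<beta> 0" "\<beta> 0 \<le> 1"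
    and alpha: "\<And>k. k \<ge> 1 \<Longrightarrow> \<alpha> k = 1 / (real k * \<sigma>)"
    and beta: "\<And>k. k \<ge> 1 \<Longrightarrow> \<beta> k = 1 / (real k * \<sigma>) powr (2/3)"
    and scgd: "basic_scgd M w v f\<^sub>v g\<^sub>w Gw X \<alpha> \<beta> x\<^sub>0 y\<^sub>0 x y"
  shows "(\<forall>k\<ge>1. integrable M (\<lambda>\<omega>. (norm (x k \<omega> - x_opt))\<^sup>2)) \<and>
    (\<forall>k\<ge>1. integrable M (\<lambda>\<omega>. (norm (tail_average x k \<omega> - x_opt))\<^sup>2)) \<and>
    (let err = (\<lambda>k. \<integral>\<omega>. (norm (x k \<omega> - x_opt))\<^sup>2 \<partial>M);
         rate = (\<lambda>k. C\<^sub>f * C\<^sub>g / \<sigma>\<^sup>2 * (ln (real k) / real k)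
           + L\<^sub>f\<^sup>2 * C\<^sub>g * (C\<^sub>f * C\<^sub>g\<^sup>2 + V\<^sub>g) / \<sigma> powr (8/3) * (1 / real k powr (2/3)));
         avg_err = (\<lambda>k. \<integral>\<omega>. (norm (tail_average x k \<omega> - x_opt))\<^sup>2 \<partial>M)
     in seq_bigO err rate \<and>
        seq_bigO rate (\<lambda>k. 1 / real k powr (2/3)) \<and>
        seq_bigO err (\<lambda>k. 1 / real k powr (2/3)) \<and>
        seq_bigO avg_err (\<lambda>k. 1 / real k powr (2/3)))"
proof -
  interpret scgd_iteration M W V w v f\<^sub>v g\<^sub>w Gw f g X C\<^sub>g C\<^sub>f V\<^sub>g L\<^sub>f \<alpha> \<beta> x\<^sub>0 y\<^sub>0 x y
    by (intro scgd_iteration.intro scgd_iteration_axioms.intro problem x0 scgd)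
  have strong: "\<sigma> * (norm (p - x_opt))\<^sup>2 \<le> (f \<circ> g) p - (f \<circ> g) x_opt" if "p \<in> X" for p
    using strong_convexity[OF that] .
  have alpha_nonneg: "\<alpha> k \<ge> 0" for k
    using initial_stepsizes(1) alpha[of k] sigma_pos by (cases "k = 0") auto
  have int: "integrable M (\<lambda>\<omega>. (norm (x k \<omega> - x_opt))\<^sup>2)" for k
    by (rule integrable_distance_all[OF alpha_nonneg sigma_pos optimal(1) strong])
  obtain D where D: "D > 0"
      "\<And>k. k \<ge> 1 \<Longrightarrow> expectation (\<lambda>\<omega>. (norm (x k \<omega> - x_opt))\<^sup>2) \<le> D * real k powr (-2/3)"
    using mean_square_error_rate[OF sigma_pos optimal(1) strong alpha_nonneg alpha beta] by blast
  define A B where "A = C\<^sub>f * C\<^sub>g / \<sigma>\<^sup>2"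
    and "B = L\<^sub>f\<^sup>2 * C\<^sub>g * (C\<^sub>f * C\<^sub>g\<^sup>2 + V\<^sub>g) / \<sigma> powr (8/3)"
  have AB: "A > 0" "B > 0"
    using constants_pos sigma_pos by (simp_all add: A_def B_def add_pos_pos)
  define rate where "rate k = A * (ln (real k) / real k) + B * (1 / real k powr (2/3))" for k
  have powr_eq: "1 / real k powr (2/3) = real k powr (-2/3)" for k
    using powr_minus_divide[of "real k" "2/3"] by simp
  \<comment> \<open>The logarithm is nonnegative from k = 1 on, and where it vanishes, at k = 1, the
    second term keeps the rate positive.\<close>
  have rate_lower: "B * real k powr (-2/3) \<le> rate k" if "k \<ge> 1" for k
    using that AB by (simp add: rate_def powr_eq)
  have rate_upper: "rate k \<le> (3 * A + B) * real k powr (-2/3)" if "k \<ge> 1" for k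
    using mult_left_mono[OF ln_over_le_powr_neg_two_thirds[of "real k"], of A] that AB
    by (simp add: rate_def powr_eq algebra_simps)
  have rate_nonneg: "rate k \<ge> 0" if "k \<ge> 1" for k
    using AB by (intro order_trans[OF _ rate_lower[OF that]]) simp
  have "seq_bigO (\<lambda>k. expectation (\<lambda>\<omega>. (norm (x k \<omega> - x_opt))\<^sup>2)) rate"
    unfolding seq_bigO_def
  \<comment> \<open>The constant has to be independent of k only, so it may contain
    \<open>B\<close>; the bound by k powr (-2/3) already implies the bound by
    \<open>rate\<close>.\<close>
  proof (intro exI[of _ "D / B"] conjI allI impI)
    fix k :: nat assume k: "k \<ge> 1"
    have "expectation (\<lambda>\<omega>. (norm (x k \<omega> - x_opt))\<^sup>2) \<le> D / B * (B * real k powr (-2/3))"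
      using D(2)[OF k] AB by simp
    also have "\<dots> \<le> D / B * rate k"
      using rate_lower[OF k] D(1) AB by (intro mult_left_mono) auto
    finally show "\<bar>expectation (\<lambda>\<omega>. (norm (x k \<omega> - x_opt))\<^sup>2)\<bar> \<le> D / B * \<bar>rate k\<bar>"
      using rate_nonneg[OF k] by simp
  qed (use D AB in simp)
  moreover have "seq_bigO rate (\<lambda>k. 1 / real k powr (2/3))"
    unfolding seq_bigO_def powr_eq
    \<comment> \<open>The 3 in \<open>3 * A + B\<close> is the constant in the bound of ln k / k by
      k powr (-2/3).\<close>
    using AB rate_upper rate_nonneg by (intro exI[of _ "3 * A + B"]) auto
  moreover have "seq_bigO (\<lambda>k. expectation (\<lambda>\<omega>. (norm (x k \<omega> - x_opt))\<^sup>2)) (\<lambda>k. 1 / real k powr (2/3))"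
    unfolding seq_bigO_def powr_eq using D by (intro exI[of _ D]) auto
  moreover have "seq_bigO (\<lambda>k. expectation (\<lambda>\<omega>. (norm (tail_average x k \<omega> - x_opt))\<^sup>2))
      (\<lambda>k. 1 / real k powr (2/3))"
    unfolding seq_bigO_def powr_eq
    using D tail_average_rate[OF borel_measurable_iterates(1) int, of _ D]
    by (intro exI[of _ "2 * D"]) auto
  moreover have "integrable M (\<lambda>\<omega>. (norm (tail_average x k \<omega> - x_opt))\<^sup>2)" if "k \<ge> 1" for k
    by (rule integrable_tail_average[OF borel_measurable_iterates(1) int that])
  ultimately show ?thesis
    using int unfolding Let_def rate_def[abs_def] A_def B_def by blast
qed

end
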